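(* Let $K$ be a regular field which is a monster model ($\kappa$-saturated and $\kappa$-strongly homogeneous for a large cardinal $\kappa$), and let $p$ be its global generic type. Suppose $K$ has a proper finite field extension $L$ of degree $n$. Identify $L$ with $K^n$, with coordinatewise addition and the multiplication given by a formula with parameters from $K$. Then the orbit of $p^{(n)}$ under the action of the multiplicative group $L^\times$ has cardinality at least $\kappa$, i.e. it is unbounded.
   Context: Setting. $K$ is a field which is itself the monster model of its complete theory. A set is small if it has cardinality $<\kappa$. Strong regularity. Let $p(x)$ be a global (i.e. over $K$) non-algebraic type. The pair $(p,\ x=x)$ is strongly regular if, for some small $A$, $p$ is $A$-invariant and for every small $B\supseteq A$ and every $a\in K$, either $a\models p|_B$ or $p|_B\vdash p|_{B\cup\{a\}}$. Regular field; generic type. $K$ is regular if such a strongly regular type $p$ concentrating on $K$ exists (equivalently, for its additive group). This $p$ is the unique global generic type; it is definable over $\emptyset$, hence invariant, so its defining scheme extends it canonically to larger models. Power type. $p^{(n)}=\mathrm{tp}(b_0,\dots,b_{n-1}/K)$, where, in an elementary extension, each $b_i$ realizes the canonical extension of $p$ to $K\cup\{b_0,\dots,b_{i-1}\}$. Action. The definable multiplication of $L=K^n$ extends to elementary extensions. For $c\in L^\times$ and $q=\mathrm{tp}(b/K)\in S_n(K)$, set $c\cdot q=\mathrm{tp}(c\cdot b/K)$. *)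

theory Defs
  imports Complex_Main
begin

unbundle cardinal_syntax

section \<open>First-order formulas and structures\<close>

text \<open>
  The type \<open>'p\<close> holds the parameters occurring in a formula: with \<open>'p = 'a\<close> this gives formulas with
  parameters from a structure on \<open>'a\<close>, and with \<open>'p = nat\<close> partitioned formulas \<open>\<phi>(x; y)\<close> without
  parameters, where \<open>Par j\<close> stands for the parameter variable \<open>y_j\<close> and \<open>inst c \<phi>\<close> is \<open>\<phi>(x; c)\<close>.

  Symbols carry no arity: a symbol stands for one symbol of each arity. A language with arities is
  covered by interpreting a symbol outside its arity trivially.
\<close>

datatype (dead 'f, pars_tm: 'p) tm =
    Var nat
  | Par 'p
  | Fn 'f "('f, 'p) tm list"
  for map: inst_tm

datatype (dead 'f, dead 'r, pars: 'p) fm =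
    Eq "('f, 'p) tm" "('f, 'p) tm"
  | Rel 'r "('f, 'p) tm list"
  | Neg "('f, 'r, 'p) fm"
  | And "('f, 'r, 'p) fm" "('f, 'r, 'p) fm"
  | Ex nat "('f, 'r, 'p) fm"
  for map: inst

primrec fv_tm :: "('f, 'p) tm \<Rightarrow> nat set" where
  "fv_tm (Var i) = {i}"
| "fv_tm (Par a) = {}"
| "fv_tm (Fn f ts) = \<Union> (set (map fv_tm ts))"

primrec fv :: "('f, 'r, 'p) fm \<Rightarrow> nat set" where
  "fv (Eq s t) = fv_tm s \<union> fv_tm t"
| "fv (Rel r ts) = \<Union> (set (map fv_tm ts))"
| "fv (Neg \<phi>) = fv \<phi>"
| "fv (And \<phi> \<psi>) = fv \<phi> \<union> fv \<psi>"
| "fv (Ex i \<phi>) = fv \<phi> - {i}"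

record ('f, 'r, 'a) struct =
  fun_int :: "'f \<Rightarrow> 'a list \<Rightarrow> 'a"
  rel_int :: "'r \<Rightarrow> 'a list \<Rightarrow> bool"

primrec eval_tm :: "('f, 'r, 'a) struct \<Rightarrow> ('p \<Rightarrow> 'a) \<Rightarrow> (nat \<Rightarrow> 'a) \<Rightarrow> ('f, 'p) tm \<Rightarrow> 'a" where
  "eval_tm M c v (Var i) = v i"
| "eval_tm M c v (Par a) = c a"
| "eval_tm M c v (Fn f ts) = fun_int M f (map (eval_tm M c v) ts)"

primrec sat :: "('f, 'r, 'a) struct \<Rightarrow> ('p \<Rightarrow> 'a) \<Rightarrow> (nat \<Rightarrow> 'a) \<Rightarrow> ('f, 'r, 'p) fm \<Rightarrow> bool" where
  "sat M c v (Eq s t) \<longleftrightarrow> eval_tm M c v s = eval_tm M c v t"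
| "sat M c v (Rel r ts) \<longleftrightarrow> rel_int M r (map (eval_tm M c v) ts)"
| "sat M c v (Neg \<phi>) \<longleftrightarrow> \<not> sat M c v \<phi>"
| "sat M c v (And \<phi> \<psi>) \<longleftrightarrow> sat M c v \<phi> \<and> sat M c v \<psi>"
| "sat M c v (Ex i \<phi>) \<longleftrightarrow> (\<exists>a. sat M c (v(i := a)) \<phi>)"

text \<open>
  A tuple is a list \<open>b\<close>, and \<open>(!) b\<close> is the assignment of its entries to the variables
  \<open>0, \<dots>, length b - 1\<close>; it is only used for formulas whose free variables are among these.
\<close>

definition fms :: "nat \<Rightarrow> 'p set \<Rightarrow> ('f, 'r, 'p) fm set" where
  "fms n B = {\<phi>. fv \<phi> \<subseteq> {..<n} \<and> pars \<phi> \<subseteq> B}"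

definition expands_field :: "('f, 'r, 'k::field) struct \<Rightarrow> bool" where
  "expands_field M \<longleftrightarrow>
     (\<exists>\<alpha> \<in> fms 3 {}. \<forall>a b c. sat M id ((!) [a, b, c]) \<alpha> \<longleftrightarrow> a + b = c) \<and>
     (\<exists>\<mu> \<in> fms 3 {}. \<forall>a b c. sat M id ((!) [a, b, c]) \<mu> \<longleftrightarrow> a * b = c)"


section \<open>Types and monster models\<close>

definition types :: "('f, 'r, 'a) struct \<Rightarrow> nat \<Rightarrow> 'a set \<Rightarrow> ('f, 'r, 'a) fm set set" where
  "types M n B = {p. p \<subseteq> fms n B \<and>
     (\<forall>F \<subseteq> p. finite F \<longrightarrow> (\<exists>v. \<forall>\<phi>\<in>F. sat M id v \<phi>)) \<and>
     (\<forall>\<phi> \<in> fms n B. \<phi> \<in> p \<or> Neg \<phi> \<in> p)}"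

definition restr :: "('f, 'r, 'a) fm set \<Rightarrow> 'a set \<Rightarrow> ('f, 'r, 'a) fm set" where
  "restr p B = {\<phi> \<in> p. pars \<phi> \<subseteq> B}"

definition realizes :: "('f, 'r, 'a) struct \<Rightarrow> 'a \<Rightarrow> ('f, 'r, 'a) fm set \<Rightarrow> bool" where
  "realizes M a p \<longleftrightarrow> (\<forall>\<phi>\<in>p. sat M id ((!) [a]) \<phi>)"

text \<open>Entailment is modulo the elementary diagram of \<open>M\<close>.\<close>

definition entails :: "('f, 'r, 'a) struct \<Rightarrow> ('f, 'r, 'a) fm set \<Rightarrow> ('f, 'r, 'a) fm set \<Rightarrow> bool" where
  "entails M P Q \<longleftrightarrow>
     (\<forall>\<psi>\<in>Q. \<exists>F \<subseteq> P. finite F \<and> (\<forall>v. (\<forall>\<phi>\<in>F. sat M id v \<phi>) \<longrightarrow> sat M id v \<psi>))"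

definition automorphism :: "('f, 'r, 'a) struct \<Rightarrow> ('a \<Rightarrow> 'a) \<Rightarrow> bool" where
  "automorphism M g \<longleftrightarrow> bij g \<and>
     (\<forall>f xs. g (fun_int M f xs) = fun_int M f (map g xs)) \<and>
     (\<forall>r xs. rel_int M r (map g xs) \<longleftrightarrow> rel_int M r xs)"

definition partial_elementary :: "('f, 'r, 'a) struct \<Rightarrow> 'a set \<Rightarrow> ('a \<Rightarrow> 'a) \<Rightarrow> bool" where
  "partial_elementary M A g \<longleftrightarrow> (\<forall>\<phi> \<in> fms 0 A. \<forall>v. sat M id v \<phi> \<longleftrightarrow> sat M g v \<phi>)"

definition saturated :: "'c rel \<Rightarrow> ('f, 'r, 'a) struct \<Rightarrow> bool" where
  "saturated \<kappa> M \<longleftrightarrow> (\<forall>B. |B| <o \<kappa> \<longrightarrow> (\<forall>p \<in> types M 1 B. \<exists>a. realizes M a p))"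

definition strongly_homogeneous :: "'c rel \<Rightarrow> ('f, 'r, 'a) struct \<Rightarrow> bool" where
  "strongly_homogeneous \<kappa> M \<longleftrightarrow>
     (\<forall>A g. |A| <o \<kappa> \<longrightarrow> partial_elementary M A g \<longrightarrow>
       (\<exists>g'. automorphism M g' \<and> (\<forall>a\<in>A. g' a = g a)))"

text \<open>
  ``Large'' is read as: greater than the number of formulas of the language, hence uncountable.
\<close>

definition monster :: "'c rel \<Rightarrow> ('f, 'r, 'a) struct \<Rightarrow> bool" where
  "monster \<kappa> M \<longleftrightarrow> Card_order \<kappa> \<and> |UNIV :: ('f, 'r, nat) fm set| <o \<kappa> \<and>
     saturated \<kappa> M \<and> strongly_homogeneous \<kappa> M"


section \<open>Strongly regular types\<close>

definition invariant :: "('f, 'r, 'a) struct \<Rightarrow> 'a set \<Rightarrow> ('f, 'r, 'a) fm set \<Rightarrow> bool" where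
  "invariant M A p \<longleftrightarrow>
     (\<forall>g. automorphism M g \<longrightarrow> (\<forall>a\<in>A. g a = a) \<longrightarrow> (\<forall>\<phi>. inst g \<phi> \<in> p \<longleftrightarrow> \<phi> \<in> p))"

definition nonalgebraic :: "('f, 'r, 'a) struct \<Rightarrow> ('f, 'r, 'a) fm set \<Rightarrow> bool" where
  "nonalgebraic M p \<longleftrightarrow> (\<forall>\<phi>\<in>p. infinite {a. sat M id ((!) [a]) \<phi>})"

text \<open>Strong regularity of the pair \<open>(p(x), x = x)\<close> for a global type \<open>p\<close>.\<close>

definition strongly_regular :: "'c rel \<Rightarrow> ('f, 'r, 'a) struct \<Rightarrow> ('f, 'r, 'a) fm set \<Rightarrow> bool" where
  "strongly_regular \<kappa> M p \<longleftrightarrow> p \<in> types M 1 UNIV \<and> nonalgebraic M p \<and>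
     (\<exists>A. |A| <o \<kappa> \<and> invariant M A p \<and>
       (\<forall>B a. A \<subseteq> B \<longrightarrow> |B| <o \<kappa> \<longrightarrow>
          realizes M a (restr p B) \<or> entails M (restr p B) (restr p (insert a B))))"


section \<open>Elementary extensions and power types\<close>

definition elementary_ext ::
    "('f, 'r, 'a) struct \<Rightarrow> ('f, 'r, 'b) struct \<Rightarrow> ('a \<Rightarrow> 'b) \<Rightarrow> bool" where
  "elementary_ext M N h \<longleftrightarrow>
     (\<forall>\<phi> :: ('f, 'r, 'a) fm. \<forall>v. sat M id v \<phi> \<longleftrightarrow> sat N h (h \<circ> v) \<phi>)"

text \<open>The type over \<open>M\<close> of a tuple of an elementary extension \<open>N\<close> of \<open>M\<close> via \<open>h\<close>.\<close>

definition tp :: "('f, 'r, 'b) struct \<Rightarrow> ('a \<Rightarrow> 'b) \<Rightarrow> 'b list \<Rightarrow> ('f, 'r, 'a) fm set" where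
  "tp N h b = {\<phi> \<in> fms (length b) UNIV. sat N h ((!) b) \<phi>}"

text \<open>
  \<open>defines_in M p \<phi> \<psi>\<close>: for all \<open>c\<close> from \<open>M\<close>, \<open>\<phi>(x; c) \<in> p\<close> iff \<open>M\<close> satisfies \<open>\<psi>(c)\<close>. Neither \<open>\<phi>\<close> nor
  \<open>\<psi>\<close> contains elements of \<open>M\<close>, so this is the defining scheme of a type definable over the empty
  set. The canonical extension of \<open>p\<close> to a subset \<open>C\<close> of \<open>N\<close> is obtained by reading it in \<open>N\<close>.
\<close>

definition defines_in ::
    "('f, 'r, 'a) struct \<Rightarrow> ('f, 'r, 'a) fm set \<Rightarrow> ('f, 'r, nat) fm \<Rightarrow> ('f, 'r, nat) fm \<Rightarrow> bool" where
  "defines_in M p \<phi> \<psi> \<longleftrightarrow> \<phi> \<in> fms 1 UNIV \<and> \<psi> \<in> fms 0 UNIV \<and>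
     (\<forall>c v. inst c \<phi> \<in> p \<longleftrightarrow> sat M c v \<psi>)"

definition canonical_ext ::
    "('f, 'r, 'a) struct \<Rightarrow> ('f, 'r, 'b) struct \<Rightarrow> ('f, 'r, 'a) fm set \<Rightarrow> 'b set \<Rightarrow> ('f, 'r, 'b) fm set"
  where
  "canonical_ext M N p C =
     {inst d \<phi> | d \<phi>. range d \<subseteq> C \<and> (\<exists>\<psi>. defines_in M p \<phi> \<psi> \<and> (\<forall>v. sat N d v \<psi>))}"

text \<open>\<open>q\<close> is the power type of \<open>p\<close> in \<open>n\<close> variables, witnessed by a tuple of \<open>N\<close>.\<close>

definition power_type ::
    "('f, 'r, 'a) struct \<Rightarrow> ('f, 'r, 'b) struct \<Rightarrow> ('a \<Rightarrow> 'b) \<Rightarrow> ('f, 'r, 'a) fm set \<Rightarrow> nat \<Rightarrow>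
     ('f, 'r, 'a) fm set \<Rightarrow> bool" where
  "power_type M N h p n q \<longleftrightarrow>
     (\<exists>b. length b = n \<and>
        (\<forall>i<n. realizes N (b ! i) (canonical_ext M N p (range h \<union> set (take i b)))) \<and>
        q = tp N h b)"


section \<open>Finite field extensions and the action on types\<close>

definition field_embedding :: "('k::field \<Rightarrow> 'l::field) \<Rightarrow> bool" where
  "field_embedding \<iota> \<longleftrightarrow> \<iota> 1 = 1 \<and> (\<forall>x y. \<iota> (x + y) = \<iota> x + \<iota> y \<and> \<iota> (x * y) = \<iota> x * \<iota> y)"

text \<open>\<open>e\<close> is an ordered basis of \<open>L\<close> (the type \<open>'l\<close>) over \<open>K\<close>, so \<open>length e\<close> is the degree.\<close>

definition basis :: "('k::field \<Rightarrow> 'l::field) \<Rightarrow> 'l list \<Rightarrow> bool" where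
  "basis \<iota> e \<longleftrightarrow> distinct e \<and>
     \<not> module.dependent (\<lambda>a x. \<iota> a * x) (set e) \<and>
     module.span (\<lambda>a x. \<iota> a * x) (set e) = UNIV"

text \<open>The identification of \<open>K^n\<close> with \<open>L\<close>.\<close>

definition of_coords :: "('k::field \<Rightarrow> 'l::field) \<Rightarrow> 'l list \<Rightarrow> 'k list \<Rightarrow> 'l" where
  "of_coords \<iota> e a = (\<Sum>i<length e. \<iota> (a ! i) * e ! i)"

definition defines_mult ::
    "('f, 'r, 'k::field) struct \<Rightarrow> ('k \<Rightarrow> 'l::field) \<Rightarrow> 'l list \<Rightarrow> ('f, 'r, 'k) fm \<Rightarrow> bool" where
  "defines_mult M \<iota> e \<mu> \<longleftrightarrow> \<mu> \<in> fms (3 * length e) UNIV \<and>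
     (\<forall>x y z. length x = length e \<longrightarrow> length y = length e \<longrightarrow> length z = length e \<longrightarrow>
        (sat M id ((!) (x @ y @ z)) \<mu> \<longleftrightarrow>
         of_coords \<iota> e x * of_coords \<iota> e y = of_coords \<iota> e z))"

text \<open>The product of \<open>c\<close> in \<open>K^n\<close> and \<open>b\<close> in \<open>N^n\<close>, given by the formula \<open>\<mu>\<close> read in \<open>N\<close>.\<close>

definition ext_mult ::
    "('f, 'r, 'b) struct \<Rightarrow> ('a \<Rightarrow> 'b) \<Rightarrow> ('f, 'r, 'a) fm \<Rightarrow> 'a list \<Rightarrow> 'b list \<Rightarrow> 'b list" where
  "ext_mult N h \<mu> c b = (THE d. length d = length b \<and> sat N h ((!) (map h c @ b @ d)) \<mu>)"

definition units_coords :: "('k::field \<Rightarrow> 'l::field) \<Rightarrow> 'l list \<Rightarrow> 'k list set" where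
  "units_coords \<iota> e = {c. length c = length e \<and> of_coords \<iota> e c \<noteq> 0}"

text \<open>
  The orbit of an \<open>n\<close>-type \<open>q\<close>. The type of \<open>c \<cdot> b\<close> over \<open>M\<close> does not depend on the realization \<open>b\<close>.
\<close>

definition orbit ::
    "('f, 'r, 'b) struct \<Rightarrow> ('a \<Rightarrow> 'b) \<Rightarrow> ('f, 'r, 'a) fm \<Rightarrow> 'a list set \<Rightarrow> nat \<Rightarrow>
     ('f, 'r, 'a) fm set \<Rightarrow> ('f, 'r, 'a) fm set set" where
  "orbit N h \<mu> U n q = {tp N h (ext_mult N h \<mu> c b) | c b. c \<in> U \<and> length b = n \<and> tp N h b = q}"

end

(*
  Two elements of K^n with the same type over a small set are conjugate by an automorphism, and a
  definable injection maps realizations of p over a set of parameters to realizations. Write cl(B) for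
  the elements not realizing p over B. Either p commutes with itself or it does not.

  If it does, cl is a pregeometry. The coefficients of the minimal polynomial of a generic element of L
  are then n independent generics, and so are the coefficients of a product of linear factors with n
  independent generic roots. The two tuples are conjugate although only one polynomial has a root in K,
  which is absurd.

  If it does not, suppose that c and c' move p^(n) to the same type and put r = c'/c. In K there is then
  an independent tuple, read as an element b of L, and an automorphism fixing r and the structure
  constants of L that maps b to r b. Let x, y and z be the first coordinates of b, r b and b/r. If r is
  not in K, then (x, y) and (x, z) are both independent pairs, and the automorphism maps (x, z) to
  (y, x), so p commutes with itself after all. Hence the stabilizer of p^(n) lies in K, and the elements
  k + a with k in K, for a fixed a in L outside K, move p^(n) to pairwise distinct types.
*)

theory Submission
  imports Defs "HOL-Computational_Algebra.Polynomial"
begin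

section \<open>Substitution and automorphisms\<close>

text \<open>The type \<open>q\<close> lives in an arbitrary elementary extension, while
  automorphisms are at hand only in K. The bridge is that \<open>p\<close> is definable from
  addition alone, by a covering condition on two translates. Read in \<open>N\<close>, this
  condition gives the canonical extension. Hence, over a small B, a realization of the power type
  satisfies the same formulas as an independent tuple of K, and equal types in \<open>N\<close>
  yield an automorphism of K.

  Regularity says that adding an element of cl(B) to B leaves cl(B) unchanged. A pregeometry also
  needs exchange, which is commutation of \<open>p\<close> with itself. Without it no dimension is
  available, only genericity of each entry over the earlier ones. This suffices: for r outside K the
  first coordinate of r b is a linear form in the entries of b with a nonzero coefficient after the
  first position, and the last such entry makes the form generic.

  The two cases meet over one base: symmetry passes to smaller bases, so a failure survives the
  addition of r and the structure constants.\<close>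

lemma eval_tm_cong:
  assumes "\<And>i. i \<in> fv_tm t \<Longrightarrow> v i = w i" and "\<And>a. a \<in> pars_tm t \<Longrightarrow> c a = d a"
  shows "eval_tm M c v t = eval_tm M d w t"
  using assms
proof (induction t)
  case (Fn f ts)
  have "eval_tm M c v t = eval_tm M d w t" if "t \<in> set ts" for t
    using that by (intro Fn.IH Fn.prems) auto
  then have "map (eval_tm M c v) ts = map (eval_tm M d w) ts"
    by simp
  then show ?case by (simp del: map_eq_conv)
qed auto

lemma sat_cong:
  assumes "\<And>i. i \<in> fv \<phi> \<Longrightarrow> v i = w i" and "\<And>a. a \<in> pars \<phi> \<Longrightarrow> c a = d a"
  shows "sat M c v \<phi> = sat M d w \<phi>"
  using assms
proof (induction \<phi> arbitrary: v w)
  case (Eq s t)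
  then have "eval_tm M c v s = eval_tm M d w s" "eval_tm M c v t = eval_tm M d w t"
    by (auto intro!: eval_tm_cong)
  then show ?case by simp
next
  case (Rel r ts)
  then have "map (eval_tm M c v) ts = map (eval_tm M d w) ts"
    by (intro map_cong eval_tm_cong) auto
  then show ?case by (simp del: map_eq_conv)
next
  case (Neg \<phi>)
  then have "sat M c v \<phi> = sat M d w \<phi>" by (auto intro!: Neg.IH)
  then show ?case by simp
next
  case (And \<phi> \<psi>)
  then have "sat M c v \<phi> = sat M d w \<phi>" by (auto intro!: And.IH)
  moreover have "sat M c v \<psi> = sat M d w \<psi>" using And by (auto intro!: And.IH)
  ultimately show ?case by simp
next
  case (Ex i \<phi>)
  then have "sat M c (v(i := a)) \<phi> = sat M d (w(i := a)) \<phi>" for a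
    by (intro Ex.IH) auto
  then show ?case by simp
qed

lemma eval_tm_inst: "eval_tm M c v (inst_tm f t) = eval_tm M (c \<circ> f) v t"
  by (induction t) (simp_all add: comp_def cong: map_cong)

lemma sat_inst: "sat M c v (inst f \<phi>) = sat M (c \<circ> f) v \<phi>"
  by (induction \<phi> arbitrary: v)
    (simp_all add: eval_tm_inst comp_def)

lemma fv_tm_inst: "fv_tm (inst_tm f t) = fv_tm t"
  by (induction t) auto

lemma fv_inst: "fv (inst f \<phi>) = fv \<phi>"
  by (induction \<phi>) (auto simp: fv_tm_inst)

lemma pars_inst: "pars (inst f \<phi>) = f ` pars \<phi>"
  by (rule fm.set_map)

lemma finite_pars_tm: "finite (pars_tm t)"
  by (induction t) auto

lemma finite_pars: "finite (pars \<phi>)"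
  by (induction \<phi>) (auto simp: finite_pars_tm)

lemma finite_fv_tm: "finite (fv_tm t)"
  by (induction t) auto

lemma finite_fv: "finite (fv \<phi>)"
  by (induction \<phi>) (auto simp: finite_fv_tm)

section \<open>Substitution and renaming\<close>

primrec subst_tm :: "(nat \<Rightarrow> nat) \<Rightarrow> ('p \<Rightarrow> ('f, 'q) tm) \<Rightarrow> ('f, 'p) tm \<Rightarrow> ('f, 'q) tm" where
  "subst_tm \<pi> s (Var i) = Var (\<pi> i)"
| "subst_tm \<pi> s (Par a) = s a"
| "subst_tm \<pi> s (Fn f ts) = Fn f (map (subst_tm \<pi> s) ts)"

text \<open>Bound variables are renamed along with free ones. Capture is therefore excluded by an
  injective \<open>\<pi>\<close> and by terms \<open>s a\<close> that avoid the range of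
  \<open>\<pi>\<close>, as \<open>sat_subst\<close> demands.\<close>

primrec subst ::
    "(nat \<Rightarrow> nat) \<Rightarrow> ('p \<Rightarrow> ('f, 'q) tm) \<Rightarrow> ('f, 'r, 'p) fm \<Rightarrow> ('f, 'r, 'q) fm" where
  "subst \<pi> s (Eq t u) = Eq (subst_tm \<pi> s t) (subst_tm \<pi> s u)"
| "subst \<pi> s (Rel r ts) = Rel r (map (subst_tm \<pi> s) ts)"
| "subst \<pi> s (Neg \<phi>) = Neg (subst \<pi> s \<phi>)"
| "subst \<pi> s (And \<phi> \<psi>) = And (subst \<pi> s \<phi>) (subst \<pi> s \<psi>)"
| "subst \<pi> s (Ex i \<phi>) = Ex (\<pi> i) (subst \<pi> s \<phi>)"

lemma eval_tm_subst:
  "eval_tm M c v (subst_tm \<pi> s t) = eval_tm M (\<lambda>a. eval_tm M c v (s a)) (v \<circ> \<pi>) t"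
  by (induction t) (simp_all add: comp_def cong: map_cong)

lemma sat_subst:
  assumes "inj \<pi>" and "\<And>a. a \<in> pars \<phi> \<Longrightarrow> fv_tm (s a) \<inter> range \<pi> = {}"
  shows "sat M c v (subst \<pi> s \<phi>) = sat M (\<lambda>a. eval_tm M c v (s a)) (v \<circ> \<pi>) \<phi>"
  using assms(2)
proof (induction \<phi> arbitrary: v)
  case (Ex i \<phi>)
  have "sat M c (v(\<pi> i := x)) (subst \<pi> s \<phi>)
      = sat M (\<lambda>a. eval_tm M c v (s a)) ((v \<circ> \<pi>)(i := x)) \<phi>" for x
  proof -
    have "sat M c (v(\<pi> i := x)) (subst \<pi> s \<phi>)
        = sat M (\<lambda>a. eval_tm M c (v(\<pi> i := x)) (s a)) (v(\<pi> i := x) \<circ> \<pi>) \<phi>"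
      using Ex.prems by (intro Ex.IH) auto
    also have "\<dots> = sat M (\<lambda>a. eval_tm M c v (s a)) ((v \<circ> \<pi>)(i := x)) \<phi>"
    proof (intro sat_cong eval_tm_cong)
      fix j show "(v(\<pi> i := x) \<circ> \<pi>) j = ((v \<circ> \<pi>)(i := x)) j"
        using assms(1) by (auto dest: injD)
    next
      fix a j assume "a \<in> pars \<phi>" "j \<in> fv_tm (s a)"
      with Ex.prems show "(v(\<pi> i := x)) j = v j" by fastforce
    qed simp
    finally show ?thesis .
  qed
  then show ?case by (simp del: fun_upd_apply o_apply add: comp_def[symmetric])
qed (simp_all add: eval_tm_subst comp_def)

lemma fv_subst_tm: "fv_tm (subst_tm \<pi> s t) \<subseteq> \<pi> ` fv_tm t \<union> (\<Union>a\<in>pars_tm t. fv_tm (s a))"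
proof (induction t)
  case (Fn f ts)
  then show ?case by fastforce
qed auto

lemma fv_subst: "fv (subst \<pi> s \<phi>) \<subseteq> \<pi> ` fv \<phi> \<union> (\<Union>a\<in>pars \<phi>. fv_tm (s a))"
proof (induction \<phi>)
  case (Eq t u)
  then show ?case using fv_subst_tm[of \<pi> s t] fv_subst_tm[of \<pi> s u] by auto
next
  case (Rel r ts)
  have "fv_tm (subst_tm \<pi> s t) \<subseteq> \<pi> ` fv (Rel r ts) \<union> (\<Union>a\<in>pars (Rel r ts). fv_tm (s a))"
    if "t \<in> set ts" for t
    using that fv_subst_tm[of \<pi> s t] by fastforce
  then show ?case by auto
qed auto

lemma pars_subst_tm: "pars_tm (subst_tm \<pi> s t) = (\<Union>a\<in>pars_tm t. pars_tm (s a))"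
  by (induction t) auto

lemma pars_subst: "pars (subst \<pi> s \<phi>) = (\<Union>a\<in>pars \<phi>. pars_tm (s a))"
  by (induction \<phi>) (auto simp: pars_subst_tm)

definition rename :: "(nat \<Rightarrow> nat) \<Rightarrow> ('f, 'r, 'p) fm \<Rightarrow> ('f, 'r, 'p) fm" where
  "rename \<pi> = subst \<pi> Par"

lemma sat_rename: "inj \<pi> \<Longrightarrow> sat M c v (rename \<pi> \<phi>) = sat M c (v \<circ> \<pi>) \<phi>"
  by (simp add: rename_def sat_subst)

lemma fv_rename: "fv (rename \<pi> \<phi>) \<subseteq> \<pi> ` fv \<phi>"
  using fv_subst[of \<pi> Par \<phi>] by (auto simp: rename_def)

lemma pars_rename: "pars (rename \<pi> \<phi>) = pars \<phi>"
  by (simp add: rename_def pars_subst)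

text \<open>Substitution by a quantifier keeps \<open>t\<close> outside the scopes within
  \<open>\<phi>\<close>, so no variable of \<open>t\<close> is captured there; only \<open>i\<close>
  itself has to be absent from \<open>t\<close>.\<close>

definition plug :: "nat \<Rightarrow> ('f, 'p) tm \<Rightarrow> ('f, 'r, 'p) fm \<Rightarrow> ('f, 'r, 'p) fm" where
  "plug i t \<phi> = Ex i (And (Eq (Var i) t) \<phi>)"

lemma sat_plug:
  assumes "i \<notin> fv_tm t"
  shows "sat M c v (plug i t \<phi>) = sat M c (v(i := eval_tm M c v t)) \<phi>"
proof -
  have "eval_tm M c (v(i := a)) t = eval_tm M c v t" for a
    using assms by (intro eval_tm_cong) auto
  then show ?thesis by (auto simp: plug_def)
qed

lemma fv_plug: "fv (plug i t \<phi>) \<subseteq> fv_tm t \<union> (fv \<phi> - {i})"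
  by (auto simp: plug_def)

lemma pars_plug: "pars (plug i t \<phi>) = pars_tm t \<union> pars \<phi>"
  by (auto simp: plug_def)

primrec plugs :: "nat \<Rightarrow> 'p list \<Rightarrow> ('f, 'r, 'p) fm \<Rightarrow> ('f, 'r, 'p) fm" where
  "plugs k [] \<phi> = \<phi>"
| "plugs k (a # as) \<phi> = plug k (Par a) (plugs (Suc k) as \<phi>)"

lemma sat_plugs:
  "sat M c v (plugs k as \<phi>)
    = sat M c (\<lambda>i. if k \<le> i \<and> i < k + length as then c (as ! (i - k)) else v i) \<phi>"
proof (induction as arbitrary: k v)
  case (Cons a as)
  have "(\<lambda>i. if Suc k \<le> i \<and> i < Suc k + length as then c (as ! (i - Suc k))
        else (v(k := c a)) i) =
      (\<lambda>i. if k \<le> i \<and> i < k + length (a # as) then c ((a # as) ! (i - k)) else v i)"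
    by (auto simp: fun_eq_iff nth_Cons' Suc_diff_Suc)
  then show ?case
    by (simp add: sat_plug Cons.IH del: fun_upd_apply)
next
  case Nil
  show ?case by (auto intro!: sat_cong)
qed

lemma fv_plugs: "fv (plugs k as \<phi>) \<subseteq> fv \<phi> - {k..<k + length as}"
proof (induction as arbitrary: k)
  case (Cons a as)
  have "fv (plugs (Suc k) as \<phi>) \<subseteq> fv \<phi> - {Suc k..<Suc k + length as}" by (rule Cons.IH)
  moreover have "fv (plugs k (a # as) \<phi>) \<subseteq> fv (plugs (Suc k) as \<phi>) - {k}"
    using fv_plug[of k "Par a"] by auto
  ultimately show ?case by fastforce
qed simp

lemma pars_plugs: "pars (plugs k as \<phi>) = set as \<union> pars \<phi>"
  by (induction as arbitrary: k) (auto simp: pars_plug)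

primrec exs :: "nat list \<Rightarrow> ('f, 'r, 'p) fm \<Rightarrow> ('f, 'r, 'p) fm" where
  "exs [] \<phi> = \<phi>"
| "exs (i # js) \<phi> = Ex i (exs js \<phi>)"

lemma sat_exs: "sat M c v (exs js \<phi>) \<longleftrightarrow> (\<exists>w. (\<forall>i. i \<notin> set js \<longrightarrow> w i = v i) \<and> sat M c w \<phi>)"
proof (induction js arbitrary: v)
  case Nil
  have "w = v" if "\<forall>i. w i = v i" for w using that by auto
  then show ?case by auto
next
  case (Cons i js)
  show ?case
  proof
    assume "sat M c v (exs (i # js) \<phi>)"
    then obtain a w where "\<forall>j. j \<notin> set js \<longrightarrow> w j = (v(i := a)) j" "sat M c w \<phi>"
      using Cons by auto
    then show "\<exists>w. (\<forall>j. j \<notin> set (i # js) \<longrightarrow> w j = v j) \<and> sat M c w \<phi>"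
      by (intro exI[of _ w]) auto
  next
    assume "\<exists>w. (\<forall>j. j \<notin> set (i # js) \<longrightarrow> w j = v j) \<and> sat M c w \<phi>"
    then obtain w where w: "\<forall>j. j \<notin> set (i # js) \<longrightarrow> w j = v j" "sat M c w \<phi>" by blast
    then have "\<exists>w'. (\<forall>j. j \<notin> set js \<longrightarrow> w' j = (v(i := w i)) j) \<and> sat M c w' \<phi>"
      by (intro exI[of _ w]) auto
    then have "sat M c (v(i := w i)) (exs js \<phi>)" using Cons by blast
    then show "sat M c v (exs (i # js) \<phi>)" by auto
  qed
qed

lemma fv_exs: "fv (exs js \<phi>) = fv \<phi> - set js"
  by (induction js) auto

lemma pars_exs: "pars (exs js \<phi>) = pars \<phi>"
  by (induction js) auto

section \<open>Automorphisms and elementary extensions\<close>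

lemma automorphism_sat:
  fixes M :: "('f, 'r, 'a) struct" and \<phi> :: "('f, 'r, 'p) fm"
  assumes "automorphism M g"
  shows "sat M (g \<circ> c) (g \<circ> v) \<phi> = sat M c v \<phi>"
proof -
  have tm: "eval_tm M (g \<circ> c) (g \<circ> v) t = g (eval_tm M c v t)" for v and t :: "('f, 'p) tm"
  proof (induction t)
    case (Fn f ts)
    have "map (eval_tm M (g \<circ> c) (g \<circ> v)) ts = map g (map (eval_tm M c v) ts)"
      unfolding map_map by (rule map_cong[OF refl], subst o_apply, rule Fn.IH)
    then have "eval_tm M (g \<circ> c) (g \<circ> v) (Fn f ts) = fun_int M f (map g (map (eval_tm M c v) ts))"
      by (simp only: eval_tm.simps)
    then show ?case using assms by (simp add: automorphism_def del: map_map map_eq_conv o_apply)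
  qed auto
  show ?thesis
  proof (induction \<phi> arbitrary: v)
    case (Eq s t)
    have "inj g" using assms by (auto simp: automorphism_def bij_def)
    then show ?case by (simp add: tm inj_eq del: o_apply)
  next
    case (Rel r ts)
    have "map (eval_tm M (g \<circ> c) (g \<circ> v)) ts = map g (map (eval_tm M c v) ts)"
      unfolding map_map by (rule map_cong[OF refl], subst o_apply, rule tm)
    then show ?case using assms by (simp add: automorphism_def del: map_map map_eq_conv o_apply)
  next
    case (Ex i \<phi>)
    have "surj g" using assms by (auto simp: automorphism_def bij_def)
    have "(g \<circ> v)(i := g a) = g \<circ> v(i := a)" for a by auto
    then have "sat M (g \<circ> c) ((g \<circ> v)(i := g a)) \<phi> = sat M c (v(i := a)) \<phi>" for a
      by (simp only: Ex.IH)
    then have "(\<exists>b. sat M (g \<circ> c) ((g \<circ> v)(i := b)) \<phi>) \<longleftrightarrow> (\<exists>a. sat M c (v(i := a)) \<phi>)"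
      using \<open>surj g\<close> by (metis surjD)
    then show ?case by (simp only: sat.simps)
  qed auto
qed

lemma automorphism_inv:
  assumes "automorphism M g"
  shows "automorphism M (inv g)"
proof -
  have b: "bij g" using assms by (auto simp: automorphism_def)
  then have g: "g (inv g x) = x" "inv g (g x) = x" for x
    by (simp_all add: bij_is_surj surj_f_inv_f bij_is_inj)
  then have *: "map g (map (inv g) xs) = xs" for xs by (simp add: comp_def)
  have "g (fun_int M f (map (inv g) xs)) = fun_int M f (map g (map (inv g) xs))" for f xs
    using assms by (simp add: automorphism_def)
  then have "inv g (fun_int M f xs) = fun_int M f (map (inv g) xs)" for f xs
    by (metis * g(2))
  moreover have "rel_int M r (map g (map (inv g) xs)) = rel_int M r (map (inv g) xs)" for r xs
    using assms unfolding automorphism_def by blast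
  then have "rel_int M r (map (inv g) xs) = rel_int M r xs" for r xs
    by (simp only: *)
  ultimately show ?thesis using b by (simp add: automorphism_def bij_imp_bij_inv)
qed

lemma automorphism_comp:
  "automorphism M f \<Longrightarrow> automorphism M g \<Longrightarrow> automorphism M (f \<circ> g)"
  unfolding automorphism_def by (auto simp: bij_comp map_map[symmetric] simp del: map_map)

text \<open>\<open>elementary_ext\<close> speaks only of assignments with values in the image of
  \<open>h\<close>. Closing \<open>Neg \<phi>\<close> existentially over its free variables makes
  the assignment immaterial, so a counterexample in \<open>N\<close> yields one in
  \<open>M\<close>.\<close>

lemma elementary_ext_valid:
  fixes M :: "('f, 'r, 'a) struct" and \<phi> :: "('f, 'r, 'a) fm"
  assumes "elementary_ext M N h" and "\<And>v. sat M id v \<phi>"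
  shows "sat N h w \<phi>"
proof (rule ccontr)
  assume neg: "\<not> sat N h w \<phi>"
  obtain js where js: "set js = fv \<phi>" using finite_fv finite_list by blast
  fix v :: "nat \<Rightarrow> 'a"
  obtain u where "u = (\<lambda>i. if i \<in> fv \<phi> then w i else (h \<circ> v) i)" by simp
  moreover from this have "\<not> sat N h u \<phi>" using neg sat_cong[of \<phi> u w h h N] by auto
  ultimately have "\<exists>u. (\<forall>i. i \<notin> fv \<phi> \<longrightarrow> u i = (h \<circ> v) i) \<and> \<not> sat N h u \<phi>"
    by (intro exI[of _ u]) auto
  then have "sat N h (h \<circ> v) (exs js (Neg \<phi>))" by (simp add: sat_exs js)
  then have "sat M id v (exs js (Neg \<phi>))" using assms(1) by (simp add: elementary_ext_def)
  then show False using assms(2) by (auto simp: sat_exs)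
qed

section \<open>The closure operator of a strongly regular type\<close>

lemma sat_nth_cong:
  assumes "\<phi> \<in> fms n B" and "\<And>i. i < n \<Longrightarrow> v i = w i" and "\<And>a. a \<in> B \<Longrightarrow> c a = d a"
  shows "sat M c v \<phi> = sat M d w \<phi>"
  using assms by (intro sat_cong) (auto simp: fms_def)

locale regular_field_structure =
  fixes M :: "('f, 'r, 'k::field) struct" and \<kappa> :: "'c rel"
    and p :: "('f, 'r, 'k) fm set" and A :: "'k set"
  assumes expands: "expands_field M"
    and monster: "monster \<kappa> M"
    and type_p: "p \<in> types M 1 UNIV"
    and nonalg: "nonalgebraic M p"
    and small_A: "|A| <o \<kappa>"
    and invariant_p: "invariant M A p"
    and regular_p: "\<And>B a. A \<subseteq> B \<Longrightarrow> |B| <o \<kappa> \<Longrightarrow>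
      realizes M a (restr p B) \<or> entails M (restr p B) (restr p (insert a B))"
begin

text \<open>The conditions on \<open>B\<close> are those under which \<open>regular_p\<close>
  applies.\<close>

definition base :: "'k set \<Rightarrow> bool" where
  "base B \<longleftrightarrow> A \<subseteq> B \<and> |B| <o \<kappa>"

definition cl :: "'k set \<Rightarrow> 'k set" where
  "cl B = {a. \<not> realizes M a (restr p B)}"

definition auts :: "'k set \<Rightarrow> ('k \<Rightarrow> 'k) set" where
  "auts B = {g. automorphism M g \<and> (\<forall>a\<in>B. g a = a)}"

text \<open>\<kappa> exceeds the number of formulas, and the equations of a variable with itself are
  already infinitely many.\<close>

lemma infinite_Field: "infinite (Field \<kappa>)"
proof -
  have inj: "inj (\<lambda>i. Eq (Var i) (Var i) :: ('f, 'r, nat) fm)" by (auto intro: injI)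
  have "infinite (UNIV :: ('f, 'r, nat) fm set)"
    using range_inj_infinite[OF inj] by (meson infinite_super subset_UNIV)
  moreover have "|UNIV :: ('f, 'r, nat) fm set| <o \<kappa>" "Card_order \<kappa>"
    using monster by (auto simp: monster_def)
  ultimately show ?thesis
    by (metis card_of_ordLeq_infinite card_of_Field_ordIso ordIso_symmetric ordLess_imp_ordLeq
        ordLeq_ordIso_trans)
qed

lemma small_finite: "finite C \<Longrightarrow> |C| <o \<kappa>"
  using infinite_Field monster finite_ordLess_infinite[OF card_of_Well_order[of C], of \<kappa>]
  by (simp add: monster_def card_order_on_well_order_on Field_card_of)

lemma small_Un: "|B| <o \<kappa> \<Longrightarrow> |C| <o \<kappa> \<Longrightarrow> |B \<union> C| <o \<kappa>"
  using infinite_Field monster card_of_Un_ordLess_infinite_Field unfolding monster_def by blast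

lemma base_Un: "base B \<Longrightarrow> finite C \<Longrightarrow> base (B \<union> C)"
  using small_Un small_finite by (auto simp: base_def)

lemma base_insert: "base B \<Longrightarrow> base (insert a B)"
  using base_Un[of B "{a}"] by simp

lemma base_A: "base A"
  by (simp add: base_def small_A)

lemma autsD: "g \<in> auts B \<Longrightarrow> a \<in> B \<Longrightarrow> g a = a"
  by (simp add: auts_def)

lemma auts_bij: "g \<in> auts B \<Longrightarrow> bij g"
  by (simp add: auts_def automorphism_def)

lemma auts_inv: "g \<in> auts B \<Longrightarrow> inv g \<in> auts B"
  unfolding auts_def using automorphism_inv
  by (auto simp: automorphism_def inv_f_eq bij_is_inj)

lemma auts_comp: "f \<in> auts B \<Longrightarrow> g \<in> auts B \<Longrightarrow> f \<circ> g \<in> auts B"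
  by (auto simp: auts_def automorphism_comp)

lemma auts_mono: "B \<subseteq> C \<Longrightarrow> auts C \<subseteq> auts B"
  by (auto simp: auts_def)

lemma auts_insert: "g \<in> auts (insert a B) \<longleftrightarrow> g \<in> auts B \<and> g a = a"
  by (auto simp: auts_def)

text \<open>Addition need not be a symbol of the language, but a formula without parameters defines
  it, and automorphisms preserve that formula.\<close>

lemma auts_add:
  assumes "g \<in> auts B"
  shows "g (a + b) = g a + g b"
proof -
  obtain \<alpha> where \<alpha>: "\<alpha> \<in> fms 3 {}" "\<And>a b c. sat M id ((!) [a, b, c]) \<alpha> \<longleftrightarrow> a + b = c"
    using expands by (auto simp: expands_field_def)
  have "sat M (g \<circ> id) (g \<circ> (!) [a, b, a + b]) \<alpha>"
    using assms \<alpha>(2) by (subst automorphism_sat) (auto simp: auts_def)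
  also have "sat M (g \<circ> id) (g \<circ> (!) [a, b, a + b]) \<alpha> = sat M id ((!) [g a, g b, g (a + b)]) \<alpha>"
    using \<alpha>(1) by (rule sat_nth_cong) (auto simp: less_Suc_eq numeral_3_eq_3)
  finally show ?thesis using \<alpha>(2) by simp
qed

lemma auts_mult:
  assumes "g \<in> auts B"
  shows "g (a * b) = g a * g b"
proof -
  obtain \<alpha> where \<alpha>: "\<alpha> \<in> fms 3 {}" "\<And>a b c. sat M id ((!) [a, b, c]) \<alpha> \<longleftrightarrow> a * b = c"
    using expands by (auto simp: expands_field_def)
  have "sat M (g \<circ> id) (g \<circ> (!) [a, b, a * b]) \<alpha>"
    using assms \<alpha>(2) by (subst automorphism_sat) (auto simp: auts_def)
  also have "sat M (g \<circ> id) (g \<circ> (!) [a, b, a * b]) \<alpha> = sat M id ((!) [g a, g b, g (a * b)]) \<alpha>"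
    using \<alpha>(1) by (rule sat_nth_cong) (auto simp: less_Suc_eq numeral_3_eq_3)
  finally show ?thesis using \<alpha>(2) by simp
qed

lemma auts_0: "g \<in> auts B \<Longrightarrow> g 0 = 0"
  using auts_add[of g B 0 0] by (metis add_cancel_right_right)

lemma auts_1:
  assumes "g \<in> auts B" shows "g 1 = 1"
proof -
  have "g 1 \<noteq> g 0" using auts_bij[OF assms] by (metis bij_is_inj inj_eq zero_neq_one)
  then show ?thesis using auts_mult[OF assms, of 1 1] auts_0[OF assms] by simp
qed

lemma auts_minus: "g \<in> auts B \<Longrightarrow> g (- a) = - g a"
  using auts_add[of g B a "- a"] auts_0[of g B] by (simp add: eq_neg_iff_add_eq_0 add.commute)

lemma auts_diff: "g \<in> auts B \<Longrightarrow> g (a - b) = g a - g b"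
  using auts_add[of g B a "- b"] auts_minus by simp

lemma auts_sum: "g \<in> auts B \<Longrightarrow> g (sum f X) = (\<Sum>x\<in>X. g (f x))"
  by (induction X rule: infinite_finite_induct) (auto simp: auts_0 auts_add)

lemma auts_power: "g \<in> auts B \<Longrightarrow> g (a ^ m) = g a ^ m"
  by (induction m) (auto simp: auts_1 auts_mult)

section \<open>Closure and genericity\<close>

lemma p_fms: "\<phi> \<in> p \<Longrightarrow> \<phi> \<in> fms 1 UNIV"
  using type_p by (auto simp: types_def)

lemma cl_mono: "B \<subseteq> C \<Longrightarrow> cl B \<subseteq> cl C"
  by (auto simp: cl_def realizes_def restr_def)

text \<open>Completeness of \<open>p\<close> turns realization into an equivalence: a formula
  outside \<open>p\<close> has its negation in \<open>p\<close>.\<close>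

lemma not_in_cl_sat:
  assumes "x \<notin> cl B" "\<phi> \<in> fms 1 B"
  shows "sat M id ((!) [x]) \<phi> \<longleftrightarrow> \<phi> \<in> p"
proof
  assume "\<phi> \<in> p"
  then show "sat M id ((!) [x]) \<phi>"
    using assms by (auto simp: cl_def realizes_def restr_def fms_def)
next
  assume s: "sat M id ((!) [x]) \<phi>"
  show "\<phi> \<in> p"
  proof (rule ccontr)
    assume "\<phi> \<notin> p"
    moreover have "\<phi> \<in> fms 1 UNIV" using assms by (auto simp: fms_def)
    ultimately have "Neg \<phi> \<in> p" using type_p by (auto simp: types_def)
    moreover have "pars (Neg \<phi>) \<subseteq> B" using assms by (simp add: fms_def)
    ultimately have "sat M id ((!) [x]) (Neg \<phi>)"
      using assms unfolding cl_def realizes_def restr_def by blast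
    then show False using s by simp
  qed
qed

lemma ex_not_in_cl:
  assumes "base B" shows "\<exists>x. x \<notin> cl B"
proof -
  have "restr p B \<in> types M 1 B"
  proof -
    have "\<phi> \<in> restr p B \<or> Neg \<phi> \<in> restr p B" if "\<phi> \<in> fms 1 B" for \<phi>
      using that type_p by (auto simp: types_def restr_def fms_def)
    moreover have "restr p B \<subseteq> fms 1 B" using p_fms by (auto simp: restr_def fms_def)
    moreover have "\<exists>v. \<forall>\<phi>\<in>F. sat M id v \<phi>" if "F \<subseteq> restr p B" "finite F" for F
      using that type_p by (simp add: types_def restr_def subset_iff)
    ultimately show ?thesis by (simp add: types_def)
  qed
  then show ?thesis using assms monster by (auto simp: base_def monster_def saturated_def cl_def)
qed

text \<open>An element b of \<open>B\<close> outside \<open>cl B\<close> would put the formula x = b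
  into \<open>p\<close>, although it has a single solution.\<close>

lemma subset_cl: "B \<subseteq> cl B"
proof
  fix b assume "b \<in> B"
  let ?\<phi> = "Eq (Var 0) (Par b) :: ('f, 'r, 'k) fm"
  have \<phi>: "?\<phi> \<in> fms 1 B" using \<open>b \<in> B\<close> by (auto simp: fms_def)
  show "b \<in> cl B"
  proof (rule ccontr)
    assume "b \<notin> cl B"
    from not_in_cl_sat[OF this \<phi>] have "?\<phi> \<in> p" by simp
    then have "infinite {a. sat M id ((!) [a]) ?\<phi>}" using nonalg by (auto simp: nonalgebraic_def)
    then show False by simp
  qed
qed

text \<open>This is where strong regularity enters. As \<open>a\<close> does not realize
  \<open>p\<close> over \<open>B\<close>, the restriction to \<open>B\<close> entails the one to
  \<open>insert a B\<close>, so both have the same realizations.\<close>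

lemma cl_insert:
  assumes "base B" "a \<in> cl B" shows "cl (insert a B) = cl B"
proof
  show "cl B \<subseteq> cl (insert a B)" by (rule cl_mono) auto
  have e: "entails M (restr p B) (restr p (insert a B))"
    using regular_p[of B a] assms by (auto simp: base_def cl_def)
  show "cl (insert a B) \<subseteq> cl B"
  proof
    fix x assume "x \<in> cl (insert a B)"
    then obtain \<psi> where \<psi>: "\<psi> \<in> restr p (insert a B)" "\<not> sat M id ((!) [x]) \<psi>"
      by (auto simp: cl_def realizes_def)
    then obtain F where F: "F \<subseteq> restr p B" "\<forall>v. (\<forall>\<phi>\<in>F. sat M id v \<phi>) \<longrightarrow> sat M id v \<psi>"
      using e by (auto simp: entails_def)
    then obtain \<phi> where "\<phi> \<in> F" "\<not> sat M id ((!) [x]) \<phi>" using \<psi> by blast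
    then show "x \<in> cl B" using F by (auto simp: cl_def realizes_def)
  qed
qed

lemma cl_absorb:
  assumes "base B" "finite F" "F \<subseteq> cl B"
  shows "cl (B \<union> F) = cl B"
  using assms(2,3)
proof induction
  case (insert x F)
  then have "x \<in> cl (B \<union> F)" by simp
  then have "cl (insert x (B \<union> F)) = cl (B \<union> F)"
    using base_Un[OF assms(1) insert.hyps(1)] by (intro cl_insert)
  then show ?case using insert by simp
qed simp

text \<open>Strong homogeneity extends the map that is the identity on \<open>B\<close> and sends
  \<open>w ! j\<close> to \<open>w' ! j\<close>. Equality of the two types over \<open>B\<close>
  makes this map well defined and elementary.\<close>

lemma conjugate_tuples:
  assumes "|B| <o \<kappa>" and len: "length w = n" "length w' = n"
    and same: "\<And>\<chi>. \<chi> \<in> fms n B \<Longrightarrow> sat M id ((!) w) \<chi> \<longleftrightarrow> sat M id ((!) w') \<chi>"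
  shows "\<exists>g\<in>auts B. map g w = w'"
proof -
  \<comment> \<open>The list \<open>w\<close> may repeat entries or meet \<open>B\<close>. The
    equations among the formulas in \<open>same\<close> show that the chosen position does not
    matter.\<close>
  define idx where "idx a = (SOME j. j < n \<and> w ! j = a)" for a
  have idx: "idx a < n \<and> w ! idx a = a" if "a \<in> set w" for a
  proof -
    have "\<exists>j. j < n \<and> w ! j = a" using that len by (auto simp: in_set_conv_nth)
    then show ?thesis unfolding idx_def by (rule someI_ex)
  qed
  define g where "g a = (if a \<in> B then a else w' ! idx a)" for a
  have gw: "g (w ! j) = w' ! j" if "j < n" for j
  proof (cases "w ! j \<in> B")
    case True
    then have "Eq (Var j) (Par (w ! j)) \<in> fms n B" using that by (auto simp: fms_def)
    from same[OF this] show ?thesis using True by (simp add: g_def)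
  next
    case False
    have i: "idx (w ! j) < n" "w ! idx (w ! j) = w ! j" using idx that len by auto
    then have "Eq (Var j) (Var (idx (w ! j))) \<in> fms n B" using that by (auto simp: fms_def)
    from same[OF this] show ?thesis using False i by (simp add: g_def)
  qed
  have "partial_elementary M (B \<union> set w) g"
    unfolding partial_elementary_def
  proof (intro ballI allI)
    fix \<phi> :: "('f, 'r, 'k) fm" and v assume \<phi>: "\<phi> \<in> fms 0 (B \<union> set w)"
    \<comment> \<open>The entries of \<open>w\<close> outside \<open>B\<close> become the first \<open>n\<close> variables of \<open>\<chi>\<close>.\<close>
    define s :: "'k \<Rightarrow> ('f, 'k) tm" where "s a = (if a \<in> B then Par a else Var (idx a))" for a
    define \<chi> where "\<chi> = subst (\<lambda>i. i + n) s \<phi>"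
    \<comment> \<open>The shift by \<open>n\<close> moves the bound variables of
      \<open>\<phi>\<close> away from the variables below \<open>n\<close> that \<open>s\<close>
      introduces.\<close>
    have s1: "fv_tm (s a) \<inter> range (\<lambda>i. i + n) = {}" if "a \<in> pars \<phi>" for a
      using that \<phi> idx[of a] by (auto simp: s_def fms_def)
    have "fv \<phi> = {}" using \<phi> by (simp add: fms_def)
    have fv: "fv_tm (s a) \<subseteq> {..<n}" "pars_tm (s a) \<subseteq> B" if "a \<in> pars \<phi>" for a
      using that \<phi> idx[of a] by (auto simp: s_def fms_def)
    have "fv \<chi> \<subseteq> {..<n}"
      using fv_subst[of "\<lambda>i. i + n" s \<phi>] fv \<open>fv \<phi> = {}\<close> unfolding \<chi>_def by blast
    moreover have "pars \<chi> \<subseteq> B" using fv unfolding \<chi>_def pars_subst by blast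
    ultimately have "\<chi> \<in> fms n B" by (simp add: fms_def)
    from same[OF this] have "sat M id ((!) w) \<chi> \<longleftrightarrow> sat M id ((!) w') \<chi>" .
    moreover have "sat M id ((!) w) \<chi> \<longleftrightarrow> sat M id v \<phi>"
      unfolding \<chi>_def using s1 \<open>fv \<phi> = {}\<close> \<phi> idx
      by (subst sat_subst) (auto intro!: sat_cong simp: s_def fms_def)
    moreover have "sat M id ((!) w') \<chi> \<longleftrightarrow> sat M g v \<phi>"
      unfolding \<chi>_def using s1 \<open>fv \<phi> = {}\<close> \<phi>
      by (subst sat_subst) (auto intro!: sat_cong simp: s_def g_def fms_def)
    ultimately show "sat M id v \<phi> \<longleftrightarrow> sat M g v \<phi>" by simp
  qed
  moreover have "|B \<union> set w| <o \<kappa>" using assms(1) small_Un small_finite[of "set w"] by blast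
  ultimately obtain g' where g': "automorphism M g'" "\<forall>a\<in>B \<union> set w. g' a = g a"
    using monster unfolding monster_def strongly_homogeneous_def by blast
  then have "g' \<in> auts B" by (auto simp: auts_def g_def)
  moreover have "map g' w = w'" using g' gw len by (auto intro!: nth_equalityI)
  ultimately show ?thesis by blast
qed

lemma conjugate:
  assumes "base B" "x \<notin> cl B" "y \<notin> cl B"
  shows "\<exists>g\<in>auts B. g x = y"
  using conjugate_tuples[of B "[x]" 1 "[y]"] assms not_in_cl_sat[of _ B] by (auto simp: base_def)

text \<open>Invariance of \<open>p\<close> enters here: a formula of \<open>p\<close> that fails at
  \<open>x\<close> is carried by \<open>g\<close> to a formula of \<open>p\<close> that fails at
  \<open>g x\<close>.\<close>

lemma cl_image_subset:
  assumes "g \<in> auts A" "x \<in> cl B"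
  shows "g x \<in> cl (g ` B)"
proof -
  obtain \<phi> where \<phi>: "\<phi> \<in> p" "pars \<phi> \<subseteq> B" "\<not> sat M id ((!) [x]) \<phi>"
    using assms by (auto simp: cl_def realizes_def restr_def)
  have "inst g \<phi> \<in> p" using invariant_p \<phi> assms by (auto simp: invariant_def auts_def)
  moreover have "pars (inst g \<phi>) \<subseteq> g ` B" using \<phi> by (auto simp: pars_inst)
  moreover have "\<not> sat M id ((!) [g x]) (inst g \<phi>)"
  proof -
    have "sat M id ((!) [g x]) (inst g \<phi>) = sat M (g \<circ> id) (g \<circ> (!) [x]) \<phi>"
      unfolding sat_inst using p_fms[OF \<phi>(1)] by (intro sat_nth_cong) auto
    also have "\<dots> = sat M id ((!) [x]) \<phi>"
      using assms by (intro automorphism_sat) (simp add: auts_def)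
    finally show ?thesis using \<phi> by simp
  qed
  ultimately show ?thesis by (auto simp: cl_def realizes_def restr_def)
qed

lemma cl_image:
  assumes "g \<in> auts B" "A \<subseteq> B"
  shows "g x \<in> cl (B \<union> g ` C) \<longleftrightarrow> x \<in> cl (B \<union> C)"
proof -
  have *: "g x \<in> cl (B \<union> g ` C)" if "g \<in> auts B" "x \<in> cl (B \<union> C)" for g x C
  proof -
    have "g x \<in> cl (g ` (B \<union> C))"
      using that assms(2) auts_mono by (intro cl_image_subset) blast+
    moreover have "g ` (B \<union> C) = B \<union> g ` C" using that by (force simp: auts_def)
    ultimately show ?thesis by simp
  qed
  have "inv g (g x) = x" for x using auts_bij[OF assms(1)] by (simp add: bij_is_inj)
  then show ?thesis using *[OF assms(1), of x C] *[OF auts_inv[OF assms(1)], of "g x" "g ` C"]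
    by (auto simp: image_image)
qed

text \<open>A finite complement could be added to \<open>B\<close>; an element generic over the
  larger set would then lie in that complement and outside it.\<close>

lemma infinite_not_in_cl:
  assumes "base B" shows "infinite (- cl B)"
proof
  assume "finite (- cl B)"
  then have "base (B \<union> - cl B)" using assms by (intro base_Un)
  then obtain x where "x \<notin> cl (B \<union> - cl B)" using ex_not_in_cl by blast
  then show False using cl_mono[of B "B \<union> - cl B"] subset_cl[of "B \<union> - cl B"] by blast
qed

text \<open>The complement of \<open>cl B\<close> is a single infinite orbit of
  \<open>auts B\<close>, so a finite invariant set cannot meet it. In this way \<open>cl B\<close>
  contains whatever is algebraic over \<open>B\<close>.\<close>

lemma finite_invariant_subset_cl:
  assumes "base B" "finite X" and inv: "\<And>g x. g \<in> auts B \<Longrightarrow> x \<in> X \<Longrightarrow> g x \<in> X"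
  shows "X \<subseteq> cl B"
proof
  fix x assume "x \<in> X"
  show "x \<in> cl B"
  proof (rule ccontr)
    assume "x \<notin> cl B"
    then have "- cl B \<subseteq> X" using conjugate[OF assms(1)] inv \<open>x \<in> X\<close> by blast
    then show False using infinite_not_in_cl[OF assms(1)] assms(2) finite_subset by blast
  qed
qed

lemma fixed_in_cl:
  assumes "base B" "\<And>g. g \<in> auts B \<Longrightarrow> g x = x"
  shows "x \<in> cl B"
  using finite_invariant_subset_cl[OF assms(1), of "{x}"] assms(2) by auto

text \<open>An automorphism over \<open>B\<close> that fixes \<open>f x\<close> also fixes
  \<open>x\<close>. Thus \<open>x\<close> is in the closure of \<open>insert (f x) B\<close>, which
  equals \<open>cl B\<close> if \<open>f x\<close> is in \<open>cl B\<close>.\<close>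

lemma injective_image_not_in_cl:
  assumes "base B" "x \<notin> cl B" "inj f" and comm: "\<And>g t. g \<in> auts B \<Longrightarrow> g (f t) = f (g t)"
  shows "f x \<notin> cl B"
proof
  assume f: "f x \<in> cl B"
  have "x \<in> cl (insert (f x) B)"
    using comm \<open>inj f\<close> by (intro fixed_in_cl base_insert assms) (metis auts_insert injD)
  then show False using cl_insert[OF assms(1) f] assms(2) by simp
qed

lemma affine_not_in_cl:
  assumes "base B" "x \<notin> cl B" "a \<in> B" "a \<noteq> 0" "b \<in> B"
  shows "a * x + b \<notin> cl B"
proof (rule injective_image_not_in_cl[where f = "\<lambda>t. a * t + b"])
  show "inj (\<lambda>t. a * t + b)" using assms by (auto intro: injI)
qed (use assms in \<open>auto simp: auts_add auts_mult autsD\<close>)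

lemma reflect_not_in_cl:
  assumes "base B" "x \<notin> cl B" "b \<in> B"
  shows "b - x \<notin> cl B"
proof (rule injective_image_not_in_cl[where f = "\<lambda>t. b - t"])
  show "inj (\<lambda>t. b - t)" by (auto intro: injI)
qed (use assms in \<open>auto simp: auts_diff autsD\<close>)

text \<open>If \<open>\<phi>\<close> is in \<open>p\<close>, let \<open>a\<close> be generic over
  its parameters: every g is either generic itself or leaves \<open>a\<close> generic over g, and
  then g - a is generic. Conversely, for x generic over the parameters and \<open>a\<close>, both x
  and x - a are generic, and one of them satisfies \<open>\<phi>\<close>.\<close>

lemma mem_p_iff:
  assumes "\<phi> \<in> fms 1 UNIV"
  shows "\<phi> \<in> p \<longleftrightarrow>
    (\<exists>a. \<forall>g. sat M id ((!) [g]) \<phi> \<or> sat M id ((!) [g - a]) \<phi>)"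
proof -
  define B where "B = A \<union> pars \<phi>"
  have B: "base B" "\<phi> \<in> fms 1 C" if "B \<subseteq> C" for C
    using assms that base_Un[OF base_A finite_pars[of \<phi>]] by (auto simp: B_def fms_def)
  have b: "base B" using B(1) by blast
  show ?thesis
  proof
    assume \<phi>: "\<phi> \<in> p"
    obtain a where a: "a \<notin> cl B" using ex_not_in_cl[OF b] by blast
    have "sat M id ((!) [g]) \<phi> \<or> sat M id ((!) [g - a]) \<phi>" for g
    proof (cases "g \<in> cl B")
      case True
      then have "a \<notin> cl (insert g B)" using cl_insert[OF b] a by simp
      then have "g - a \<notin> cl (insert g B)" by (intro reflect_not_in_cl base_insert b) auto
      then show ?thesis using not_in_cl_sat[of _ "insert g B"] B(2)[of "insert g B"] \<phi> by blast
    next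
      case False
      then show ?thesis using not_in_cl_sat B(2)[of B] \<phi> by blast
    qed
    then show "\<exists>a. \<forall>g. sat M id ((!) [g]) \<phi> \<or> sat M id ((!) [g - a]) \<phi>" by blast
  next
    assume "\<exists>a. \<forall>g. sat M id ((!) [g]) \<phi> \<or> sat M id ((!) [g - a]) \<phi>"
    then obtain a where a: "\<And>g. sat M id ((!) [g]) \<phi> \<or> sat M id ((!) [g - a]) \<phi>" by blast
    have ba: "base (B \<union> {a, -a})" using b by (intro base_Un) auto
    then obtain x where x: "x \<notin> cl (B \<union> {a, -a})" using ex_not_in_cl by blast
    \<comment> \<open>\<open>affine_not_in_cl\<close> takes its constants from the base. Both -a and
      1 are therefore in it; adding 1 is harmless because automorphisms fix it.\<close>
    then have "1 * x + - a \<notin> cl (insert 1 (B \<union> {a, -a}))"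
    proof -
      have "1 \<in> cl (B \<union> {a, -a})" using ba by (intro fixed_in_cl) (auto intro: auts_1)
      then have "x \<notin> cl (insert 1 (B \<union> {a, -a}))" using x cl_insert[OF ba] by simp
      then show ?thesis by (intro affine_not_in_cl base_insert ba) auto
    qed
    moreover have "x - a = 1 * x + - a" by simp
    moreover have "\<phi> \<in> fms 1 (B \<union> {a, -a})" "\<phi> \<in> fms 1 (insert 1 (B \<union> {a, -a}))"
      by (intro B(2); blast)+
    ultimately show "\<phi> \<in> p" using a[of x] x not_in_cl_sat by metis
  qed
qed

end

section \<open>Genericity as a formula and independent tuples\<close>

text \<open>
  A formula \<open>\<phi>(x)\<close> belongs to \<open>p\<close> iff two additive translates of its solution set cover the field;
  \<open>\<alpha>\<close> defines addition, and the variables from \<open>K\<close> on are fresh.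
\<close>

definition generic_fm ::
    "('f, 'r, 'p) fm \<Rightarrow> nat \<Rightarrow> nat \<Rightarrow> ('f, 'r, 'p) fm \<Rightarrow> ('f, 'r, 'p) fm" where
  "generic_fm \<alpha> K k \<phi> =
    Ex (K + 1) (Neg (Ex (K + 2) (And
      (Neg (plug k (Var (K + 2)) \<phi>))
      (Neg (Ex K (And (rename (\<lambda>i. i + K) \<alpha>) (plug k (Var K) \<phi>)))))))"

text \<open>With \<open>\<alpha>\<close> read as u + a = g, the fresh variables \<open>K\<close>,
  \<open>K + 1\<close>, \<open>K + 2\<close> hold u, a, g. The translate g - a is thus expressed
  through addition only.\<close>

lemma sat_generic_fm:
  assumes "\<alpha> \<in> fms 3 B" "\<phi> \<in> fms K C" "k < K"
  shows "sat M c v (generic_fm \<alpha> K k \<phi>) \<longleftrightarrow>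
    (\<exists>a. \<forall>g. sat M c (v(k := g)) \<phi> \<or>
      (\<exists>u. sat M c ((!) [u, a, g]) \<alpha> \<and> sat M c (v(k := u)) \<phi>))"
proof -
  have 1: "sat M c (v(K + 1 := a, K + 2 := g)) (plug k (Var (K + 2)) \<phi>)
      = sat M c (v(k := g)) \<phi>" for a g
    using assms(2,3) by (subst sat_plug, simp, intro sat_nth_cong[OF assms(2)]) auto
  have 2: "sat M c (v(K + 1 := a, K + 2 := g, K := u)) (plug k (Var K) \<phi>)
      = sat M c (v(k := u)) \<phi>" for a g u
    using assms(2,3) by (subst sat_plug, simp, intro sat_nth_cong[OF assms(2)]) auto
  have 3: "sat M c (v(K + 1 := a, K + 2 := g, K := u)) (rename (\<lambda>i. i + K) \<alpha>)
      = sat M c ((!) [u, a, g]) \<alpha>" for a g u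
    by (subst sat_rename, simp add: inj_def, intro sat_nth_cong[OF assms(1)])
      (auto simp: less_Suc_eq numeral_3_eq_3)
  show ?thesis unfolding generic_fm_def sat.simps 1 2 3 by blast
qed

lemma generic_fm_fms:
  assumes "\<alpha> \<in> fms 3 B" "\<phi> \<in> fms (Suc k) B"
  shows "generic_fm \<alpha> (Suc k) k \<phi> \<in> fms k B"
proof -
  let ?K = "Suc k"
  have "fv (plug k (Var i) \<phi>) \<subseteq> {..<k} \<union> {i}" for i
    using assms fv_plug[of k "Var i" \<phi>] by (auto simp: fms_def less_Suc_eq subset_iff)
  moreover have "fv (rename (\<lambda>i. i + ?K) \<alpha>) \<subseteq> {?K, ?K + 1, ?K + 2}"
    using assms fv_rename[of "\<lambda>i. i + ?K" \<alpha>] by (fastforce simp: fms_def numeral_3_eq_3 less_Suc_eq)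
  ultimately have "fv (generic_fm \<alpha> ?K k \<phi>) \<subseteq> {..<k}"
    unfolding generic_fm_def fv.simps by blast
  then show ?thesis
    using assms by (auto simp: fms_def generic_fm_def pars_plug pars_rename)
qed

text \<open>
  \<open>\<Psi>(ys, x)\<close> as a formula in the single variable \<open>x\<close>, which has to be the variable \<open>0\<close>. For \<open>m > 0\<close>
  this variable is no longer free once \<open>ys\<close> is plugged in, so it can take the place of variable \<open>m\<close>.
\<close>

definition fibre_fm :: "nat \<Rightarrow> 'p list \<Rightarrow> ('f, 'r, 'p) fm \<Rightarrow> ('f, 'r, 'p) fm" where
  "fibre_fm m ys \<Psi> =
    (if m = 0 then plugs 0 ys \<Psi> else plug m (Var 0) (plugs 0 ys \<Psi>))"

lemma sat_fibre_fm:
  assumes "\<Psi> \<in> fms (Suc m) B" "length ys = m"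
  shows "sat M c v (fibre_fm m ys \<Psi>) = sat M c ((!) (map c ys @ [v 0])) \<Psi>"
proof (cases "m = 0")
  case True
  then have "sat M c v \<Psi> = sat M c ((!) [v 0]) \<Psi>"
    by (intro sat_nth_cong[OF assms(1)]) auto
  then show ?thesis using True assms(2) by (simp add: fibre_fm_def)
next
  case False
  then have "sat M c v (fibre_fm m ys \<Psi>) = sat M c (v(m := v 0)) (plugs 0 ys \<Psi>)"
    by (simp add: fibre_fm_def sat_plug)
  also have "\<dots> = sat M c ((!) (map c ys @ [v 0])) \<Psi>"
    unfolding sat_plugs using assms(2)
    by (intro sat_nth_cong[OF assms(1)]) (auto simp: nth_append less_Suc_eq)
  finally show ?thesis .
qed

lemma fibre_fm_fms:
  assumes "\<Psi> \<in> fms (Suc m) B" "length ys = m"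
  shows "fibre_fm m ys \<Psi> \<in> fms 1 (B \<union> set ys)"
proof -
  have "fv (plugs 0 ys \<Psi>) \<subseteq> {m}"
    using fv_plugs[of 0 ys \<Psi>] assms by (fastforce simp: fms_def less_Suc_eq)
  then show ?thesis
    using assms fv_plug[of m "Var 0" "plugs 0 ys \<Psi>"] unfolding fibre_fm_def fms_def
    by (auto simp: pars_plug pars_plugs)
qed

context regular_field_structure
begin

text \<open>For a base \<open>B\<close> these lists are the realizations in K of the power type
  restricted to \<open>B\<close>; compare \<open>power_type_transfer\<close>.\<close>

definition indep :: "'k set \<Rightarrow> 'k list \<Rightarrow> bool" where
  "indep B xs \<longleftrightarrow> (\<forall>i<length xs. xs ! i \<notin> cl (B \<union> set (take i xs)))"

lemma indep_Nil [simp]: "indep B []"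
  by (simp add: indep_def)

lemma indep_snoc: "indep B (xs @ [x]) \<longleftrightarrow> indep B xs \<and> x \<notin> cl (B \<union> set xs)"
  by (auto simp: indep_def nth_append less_Suc_eq)

lemma indep_Cons: "indep B (x # xs) \<longleftrightarrow> x \<notin> cl B \<and> indep (insert x B) xs"
proof -
  have "(\<forall>i<Suc n. P i) \<longleftrightarrow> P 0 \<and> (\<forall>i<n. P (Suc i))" for P and n :: nat
    using less_Suc_eq_0_disj by auto
  then show ?thesis by (simp add: indep_def)
qed

lemma ex_indep:
  assumes "base B" shows "\<exists>xs. length xs = n \<and> indep B xs"
proof (induction n)
  case (Suc n)
  then obtain xs where xs: "length xs = n" "indep B xs" by blast
  obtain x where "x \<notin> cl (B \<union> set xs)"
    using ex_not_in_cl[OF base_Un[OF assms, of "set xs"]] by auto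
  with xs show ?case by (intro exI[of _ "xs @ [x]"]) (simp add: indep_snoc)
qed simp

text \<open>Once g moves \<open>xs\<close> to \<open>ys\<close>, the image of the next entry and the
  next target are both generic over \<open>B\<close> and \<open>ys\<close>, so an automorphism that
  also fixes \<open>ys\<close> corrects the last entry.\<close>

lemma conjugate_indep:
  assumes "base B" "indep B xs" "indep B ys" "length xs = length ys"
  shows "\<exists>g\<in>auts B. map g xs = ys"
  using assms(4,2,3)
proof (induction xs arbitrary: ys rule: rev_induct)
  case Nil
  have "id \<in> auts B" by (simp add: auts_def automorphism_def)
  then show ?case using Nil by auto
next
  case (snoc x xs zs)
  then obtain ys y where zs: "zs = ys @ [y]" "length xs = length ys"
    by (metis length_append_singleton length_Suc_conv_rev)
  with snoc have *: "indep B xs" "x \<notin> cl (B \<union> set xs)" "indep B ys" "y \<notin> cl (B \<union> set ys)"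
    by (auto simp: indep_snoc)
  with snoc.IH zs obtain g where g: "g \<in> auts B" "map g xs = ys" by blast
  have "g x \<notin> cl (B \<union> g ` set xs)"
    using cl_image[OF g(1), of x "set xs"] assms(1) * by (simp add: base_def)
  moreover have "g ` set xs = set ys" using g(2) by auto
  ultimately have "\<exists>f\<in>auts (B \<union> set ys). f (g x) = y"
    using * base_Un[OF assms(1), of "set ys"] by (intro conjugate) auto
  then obtain f where f: "f \<in> auts (B \<union> set ys)" "f (g x) = y" by blast
  have "map (f \<circ> g) xs = map f ys" using g(2) by auto
  also have "\<dots> = ys" using f(1) by (auto simp: auts_def intro: map_idI)
  finally have "map (f \<circ> g) (xs @ [x]) = zs" using f(2) zs by simp
  moreover have "f \<circ> g \<in> auts B"
    using f(1) g(1) auts_mono[of B "B \<union> set ys"] by (intro auts_comp) auto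
  ultimately show ?case by blast
qed

section \<open>Symmetry of independence and Steinitz exchange\<close>

definition symmetric_over :: "'k set \<Rightarrow> bool" where
  "symmetric_over B \<longleftrightarrow>
    (\<forall>x y. x \<notin> cl B \<longrightarrow> y \<notin> cl (insert x B) \<longrightarrow> x \<notin> cl (insert y B))"

text \<open>All independent pairs over \<open>B\<close> are conjugate over \<open>B\<close>, so one
  of them decides.\<close>

lemma symmetric_over_witness:
  assumes "base B" "x \<notin> cl B" "y \<notin> cl (insert x B)" "x \<notin> cl (insert y B)"
  shows "symmetric_over B"
  unfolding symmetric_over_def
proof (intro allI impI)
  fix x' y' assume "x' \<notin> cl B" "y' \<notin> cl (insert x' B)"
  then have "\<exists>g\<in>auts B. map g [x, y] = [x', y']"
    using assms by (intro conjugate_indep) (auto simp: indep_Cons)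
  then obtain g where "g \<in> auts B" "g x = x'" "g y = y'" by auto
  then show "x' \<notin> cl (insert y' B)"
    using cl_image[of g B x "{y}"] assms by (simp add: base_def)
qed

text \<open>A pair independent over \<open>C\<close> in both orders is so over \<open>B\<close>. The
  use is by contraposition: a failure of symmetry survives the addition of parameters.\<close>

lemma symmetric_over_antimono:
  assumes "base B" "base C" "B \<subseteq> C" "symmetric_over C"
  shows "symmetric_over B"
proof -
  obtain x where x: "x \<notin> cl C" using ex_not_in_cl assms by blast
  obtain y where y: "y \<notin> cl (insert x C)" using ex_not_in_cl assms base_insert by blast
  have "x \<notin> cl (insert y C)" using x y assms by (auto simp: symmetric_over_def)
  then show ?thesis
    using x y assms cl_mono[of B C] cl_mono[of "insert x B" "insert x C"]
      cl_mono[of "insert y B" "insert y C"]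
    by (intro symmetric_over_witness[of B x y]) auto
qed

text \<open>When the elements of \<open>C\<close> are added one by one, \<open>x\<close> enters the
  closure at some step; \<open>c\<close> is the element added there.\<close>

lemma exchange_witness:
  assumes "finite C" "x \<notin> cl B" "x \<in> cl (B \<union> C)"
  shows "\<exists>C0 c. C0 \<subseteq> C \<and> c \<in> C \<and> x \<notin> cl (B \<union> C0) \<and> x \<in> cl (insert c (B \<union> C0))"
  using assms(1,3)
proof induction
  case empty
  then show ?case using assms(2) by simp
next
  case (insert c F)
  show ?case
  proof (cases "x \<in> cl (B \<union> F)")
    case True
    then show ?thesis using insert.IH by (meson subset_insertI2 insertI2)
  next
    case False
    then show ?thesis using insert.prems by (intro exI[of _ F] exI[of _ c]) auto
  qed
qed

text \<open>Steinitz exchange: \<open>x\<close> enters the closure when some c from \<open>C\<close>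
  is added, so by symmetry c lies in the closure of \<open>x\<close> and the rest. Then
  \<open>x\<close> joins the base, c is dropped from \<open>C\<close>, and the span does not
  shrink.\<close>

lemma indep_length_le:
  assumes sym: "\<And>B. base B \<Longrightarrow> symmetric_over B"
    and "base B" "indep B xs" "finite C" "set xs \<subseteq> cl (B \<union> C)"
  shows "length xs \<le> card C"
  using assms(2-)
proof (induction xs arbitrary: B C)
  case (Cons x xs)
  then have x: "x \<notin> cl B" "x \<in> cl (B \<union> C)" "indep (insert x B) xs" by (auto simp: indep_Cons)
  obtain C0 c where c: "C0 \<subseteq> C" "c \<in> C" "x \<notin> cl (B \<union> C0)" "x \<in> cl (insert c (B \<union> C0))"
    using exchange_witness[OF Cons.prems(3) x(1,2)] by blast
  have fin: "finite C0" using c(1) Cons.prems(3) finite_subset by blast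
  let ?D = "insert x B \<union> (C - {c})"
  have bD: "base ?D" using Cons.prems by (intro base_Un base_insert) auto
  have "c \<in> cl (insert x (B \<union> C0))"
    using sym[OF base_Un[OF Cons.prems(1) fin]] c by (auto simp: symmetric_over_def)
  moreover have "c \<notin> C0" using c(3,4) by (metis Un_iff insert_absorb)
  then have "insert x (B \<union> C0) \<subseteq> ?D" using c(1) by auto
  ultimately have "c \<in> cl ?D" using cl_mono by blast
  then have "C \<subseteq> cl ?D" using subset_cl[of ?D] by auto
  then have "cl (?D \<union> C) = cl ?D" using bD Cons.prems by (intro cl_absorb) auto
  moreover have "set xs \<subseteq> cl (?D \<union> C)"
    using Cons.prems(4) cl_mono[of "B \<union> C" "?D \<union> C"] by auto
  ultimately have "length xs \<le> card (C - {c})"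
    using Cons.prems x by (intro Cons.IH[of "insert x B"] base_insert) auto
  moreover have "card (C - {c}) < card C" using c(2) Cons.prems(3) by (intro card_Diff1_less)
  ultimately show ?case by simp
qed simp

text \<open>An entry in the closure of the earlier ones could be dropped, and too few elements would
  span the independent list \<open>xs\<close>.\<close>

lemma indep_if_spans:
  assumes sym: "\<And>B. base B \<Longrightarrow> symmetric_over B"
    and "base B" "indep B xs" "length ys = length xs" "set xs \<subseteq> cl (B \<union> set ys)"
  shows "indep B ys"
  unfolding indep_def
proof (intro allI impI notI)
  fix i assume i: "i < length ys" "ys ! i \<in> cl (B \<union> set (take i ys))"
  let ?C = "set (take i ys) \<union> set (drop (Suc i) ys)"
  have bC: "base (B \<union> ?C)" using assms(2) by (intro base_Un) auto
  have "ys = take i ys @ ys ! i # drop (Suc i) ys" using i(1) by (rule id_take_nth_drop)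
  then have "set ys = insert (ys ! i) ?C" by (metis Un_insert_right list.simps(15) set_append)
  moreover have "ys ! i \<in> cl (B \<union> ?C)" using i(2) cl_mono[of "B \<union> set (take i ys)" "B \<union> ?C"] by auto
  ultimately have "set ys \<subseteq> cl (B \<union> ?C)" using subset_cl[of "B \<union> ?C"] by auto
  then have "cl (B \<union> ?C \<union> set ys) = cl (B \<union> ?C)" using bC by (intro cl_absorb) auto
  then have "set xs \<subseteq> cl (B \<union> ?C)"
    using assms(5) cl_mono[of "B \<union> set ys" "B \<union> ?C \<union> set ys"] by auto
  then have "length xs \<le> card ?C" using assms by (intro indep_length_le[OF sym]) auto
  also have "\<dots> \<le> length (take i ys) + length (drop (Suc i) ys)"
    using card_Un_le card_length by (metis add_mono order_trans)
  also have "\<dots> < length ys" using i(1) by simp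
  finally show False using assms by simp
qed

lemma Neg_mem_p:
  assumes "\<phi> \<in> fms 1 UNIV"
  shows "Neg \<phi> \<in> p \<longleftrightarrow> \<phi> \<notin> p"
proof -
  have "\<forall>F\<subseteq>p. finite F \<longrightarrow> (\<exists>v. \<forall>\<psi>\<in>F. sat M id v \<psi>)" using type_p by (simp add: types_def)
  from this[rule_format, of "{\<phi>, Neg \<phi>}"] have "\<phi> \<in> p \<Longrightarrow> Neg \<phi> \<notin> p" by auto
  moreover have "\<forall>\<psi>\<in>fms 1 UNIV. \<psi> \<in> p \<or> Neg \<psi> \<in> p" using type_p by (simp add: types_def)
  ultimately show ?thesis using assms by blast
qed

text \<open>The last variable is eliminated by \<open>generic_fm\<close> on both sides. In K this is
  \<open>mem_p_iff\<close>, applied to the fibre over the earlier entries; in \<open>N\<close> it is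
  the definition of the canonical extension.\<close>

lemma power_type_transfer:
  fixes N :: "('f, 'r, 'b) struct"
  assumes "elementary_ext M N h" and "base B" "\<Psi> \<in> fms n B"
    and "indep B ys" "length ys = n" "length xs = n"
    and "\<And>i. i < n \<Longrightarrow> realizes N (xs ! i) (canonical_ext M N p (range h \<union> set (take i xs)))"
  shows "sat N h ((!) xs) \<Psi> \<longleftrightarrow> sat M id ((!) ys) \<Psi>"
  using assms(3-)
proof (induction n arbitrary: \<Psi> xs ys)
  case 0
  fix v :: "nat \<Rightarrow> 'k"
  have "sat M id v \<Psi> \<longleftrightarrow> sat N h (h \<circ> v) \<Psi>" using assms(1) by (simp add: elementary_ext_def)
  moreover have "sat N h ((!) xs) \<Psi> = sat N h (h \<circ> v) \<Psi>" using 0 by (intro sat_nth_cong) auto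
  moreover have "sat M id ((!) ys) \<Psi> = sat M id v \<Psi>" using 0 by (intro sat_nth_cong) auto
  ultimately show ?case by (simp only:)
next
  case (Suc m)
  obtain \<alpha> :: "('f, 'r, 'k) fm"
    where \<alpha>: "\<alpha> \<in> fms 3 {}" "\<And>a b c. sat M id ((!) [a, b, c]) \<alpha> \<longleftrightarrow> a + b = c"
    using expands by (auto simp: expands_field_def)
  obtain ys' y where ys: "ys = ys' @ [y]" "length ys' = m"
    using Suc.prems(3) by (metis length_Suc_conv_rev)
  obtain xs' x where xs: "xs = xs' @ [x]" "length xs' = m"
    using Suc.prems(4) by (metis length_Suc_conv_rev)
  define \<Psi>' where "\<Psi>' = generic_fm \<alpha> (Suc m) m \<Psi>"
  have \<alpha>B: "\<alpha> \<in> fms 3 B" using \<alpha>(1) by (auto simp: fms_def)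
  have nth: "sat R c (((!) zs)(m := g)) \<Psi> = sat R c ((!) (zs @ [g])) \<Psi>"
    if "length zs = m" for R :: "('f, 'r, 'd) struct" and c zs g
    using Suc.prems(1) that by (intro sat_nth_cong) (auto simp: nth_append)
  have IH: "sat N h ((!) xs') \<Psi>' \<longleftrightarrow> sat M id ((!) ys') \<Psi>'"
  proof (rule Suc.IH)
    show "\<Psi>' \<in> fms m B" unfolding \<Psi>'_def using \<alpha>B Suc.prems(1) by (rule generic_fm_fms)
    show "indep B ys'" using Suc.prems ys by (simp add: indep_snoc)
    show "realizes N (xs' ! i) (canonical_ext M N p (range h \<union> set (take i xs')))" if "i < m" for i
      using Suc.prems(5)[of i] that xs by (simp add: nth_append)
  qed (use xs ys in auto)
  have "sat M id ((!) ys) \<Psi> \<longleftrightarrow> sat M id ((!) ys') \<Psi>'"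
  proof -
    let ?\<phi> = "fibre_fm m ys' \<Psi>"
    have \<phi>: "?\<phi> \<in> fms 1 (B \<union> set ys')" by (rule fibre_fm_fms[OF Suc.prems(1) ys(2)])
    have sat\<phi>: "sat M id ((!) [g]) ?\<phi> \<longleftrightarrow> sat M id ((!) (ys' @ [g])) \<Psi>" for g
      using sat_fibre_fm[OF Suc.prems(1) ys(2), of M id] by simp
    have "sat M id ((!) ys) \<Psi> \<longleftrightarrow> ?\<phi> \<in> p"
      using not_in_cl_sat[OF _ \<phi>, of y] sat\<phi> Suc.prems ys by (simp add: indep_snoc)
    also have "\<dots> \<longleftrightarrow> (\<exists>a. \<forall>g. sat M id ((!) (ys' @ [g])) \<Psi> \<or> sat M id ((!) (ys' @ [g - a])) \<Psi>)"
      unfolding sat\<phi>[symmetric] using \<phi> by (intro mem_p_iff) (auto simp: fms_def)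
    also have "\<dots> \<longleftrightarrow> sat M id ((!) ys') \<Psi>'"
    proof -
      have "u + a = g \<longleftrightarrow> u = g - a" for u a g :: 'k by (simp add: eq_diff_eq)
      then show ?thesis
        unfolding \<Psi>'_def by (simp add: sat_generic_fm[OF \<alpha>B Suc.prems(1)] nth[OF ys(2)] \<alpha>(2))
    qed
    finally show ?thesis .
  qed
  moreover have "sat N h ((!) xs) \<Psi> \<longleftrightarrow> sat N h ((!) xs') \<Psi>'"
  proof -
    obtain ps where ps: "set ps = pars \<Psi>" using finite_list[OF finite_pars, of \<Psi>] by auto
    define idx where "idx a = (SOME j. j < length ps \<and> ps ! j = a)" for a
    have idx: "idx a < length ps \<and> ps ! idx a = a" if "a \<in> pars \<Psi>" for a
    proof -
      have "\<exists>j. j < length ps \<and> ps ! j = a" using that unfolding ps[symmetric] in_set_conv_nth .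
      then show ?thesis unfolding idx_def by (rule someI_ex)
    qed
    \<comment> \<open>\<open>canonical_ext\<close> wants formulas whose parameters are numbered. The
      numbers below \<open>m\<close> stand for \<open>xs'\<close>, the next ones for the parameters
      of \<open>\<Psi>\<close>; the default \<open>h undefined\<close> keeps the range of
      \<open>d\<close> within \<open>range h \<union> set xs'\<close>.\<close>
    define d where "d j = (if j < m then xs' ! j else
      if j - m < length ps then h (ps ! (j - m)) else h undefined)" for j
    define \<Phi> where "\<Phi> = inst (\<lambda>a. m + idx a) \<Psi>"
    have \<Phi>: "\<Phi> \<in> fms (Suc m) UNIV" using Suc.prems(1) by (simp add: \<Phi>_def fms_def fv_inst)
    define \<phi> where "\<phi> = fibre_fm m [0..<m] \<Phi>"
    have \<phi>: "\<phi> \<in> fms 1 UNIV"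
      using fibre_fm_fms[OF \<Phi>, of "[0..<m]"] by (simp add: \<phi>_def fms_def)
    \<comment> \<open>As \<open>\<alpha>\<close> has no parameters, this only changes the type of
      the parameters.\<close>
    define \<alpha>' where "\<alpha>' = inst (\<lambda>_. 0::nat) \<alpha>"
    have \<alpha>': "\<alpha>' \<in> fms 3 UNIV" using \<alpha>(1) by (simp add: \<alpha>'_def fms_def fv_inst)
    define \<psi> where "\<psi> = generic_fm \<alpha>' (Suc 0) 0 \<phi>"
    have \<psi>: "\<psi> \<in> fms 0 UNIV"
      unfolding \<psi>_def using \<alpha>' \<phi> by (intro generic_fm_fms) auto
    have \<phi>1: "\<phi> \<in> fms (Suc 0) UNIV" using \<phi> by simp
    have sat\<alpha>': "sat R c v \<alpha>' = sat R c' v \<alpha>"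
      for R :: "('f, 'r, 'd) struct" and c v c'
      unfolding \<alpha>'_def sat_inst using \<alpha>(1) by (intro sat_nth_cong) auto
    have upd: "sat R c (v(0 := g)) \<phi> = sat R c ((!) [g]) \<phi>"
      for R :: "('f, 'r, 'd) struct" and c v g
      using \<phi> by (intro sat_nth_cong) auto
    have def: "inst c \<phi> \<in> p \<longleftrightarrow> sat M c v \<psi>" for c v
    proof -
      have "inst c \<phi> \<in> p \<longleftrightarrow> (\<exists>a. \<forall>g. sat M id ((!) [g]) (inst c \<phi>) \<or> sat M id ((!) [g - a]) (inst c \<phi>))"
        using \<phi> by (intro mem_p_iff) (auto simp: fms_def fv_inst)
      moreover have "u + a = g \<longleftrightarrow> u = g - a" for u a g :: 'k by (simp add: eq_diff_eq)
      ultimately show ?thesis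
        unfolding \<psi>_def
        by (simp add: sat_generic_fm[OF \<alpha>' \<phi>1] sat_inst upd sat\<alpha>'[of M c _ id] \<alpha>(2))
    qed
    \<comment> \<open>Realizing the canonical extension gives implications only; the negated formula
      supplies the converse.\<close>
    have defs: "defines_in M p \<phi> \<psi>" "defines_in M p (Neg \<phi>) (Neg \<psi>)"
    proof -
      show "defines_in M p \<phi> \<psi>" using \<phi> \<psi> def by (simp add: defines_in_def)
      have "inst c (Neg \<phi>) \<in> p \<longleftrightarrow> inst c \<phi> \<notin> p" for c
        using Neg_mem_p[of "inst c \<phi>"] \<phi> by (simp add: fms_def fv_inst)
      then show "defines_in M p (Neg \<phi>) (Neg \<psi>)"
        using \<phi> \<psi> def by (simp add: defines_in_def fms_def)
    qed
    have sat\<phi>: "sat N d ((!) [g]) \<phi> \<longleftrightarrow> sat N h ((!) (xs' @ [g])) \<Psi>" for g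
    proof -
      have "map d [0..<m] = xs'" using xs(2) by (intro nth_equalityI) (auto simp: d_def)
      then have "sat N d ((!) [g]) \<phi> \<longleftrightarrow> sat N (d \<circ> (\<lambda>a. m + idx a)) ((!) (xs' @ [g])) \<Psi>"
        using sat_fibre_fm[OF \<Phi>, of "[0..<m]" N d "(!) [g]"] by (simp add: \<phi>_def \<Phi>_def sat_inst)
      also have "\<dots> \<longleftrightarrow> sat N h ((!) (xs' @ [g])) \<Psi>"
        by (intro sat_cong) (auto simp: d_def idx)
      finally show ?thesis .
    qed
    have sat\<psi>: "sat N d v \<psi> \<longleftrightarrow> sat N h ((!) xs') \<Psi>'" for v
      unfolding \<Psi>'_def \<psi>_def
      by (simp add: sat_generic_fm[OF \<alpha>' \<phi>1] sat_generic_fm[OF \<alpha>B Suc.prems(1)] upd sat\<phi>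
          nth[OF xs(2)] sat\<alpha>'[of N d _ h])
    have range: "range d \<subseteq> range h \<union> set xs'" using xs(2) by (auto simp: d_def)
    have mem: "inst d \<phi>' \<in> canonical_ext M N p (range h \<union> set xs')"
      if "defines_in M p \<phi>' \<psi>'" "\<forall>v. sat N d v \<psi>'" for \<phi>' \<psi>'
      unfolding canonical_ext_def
      by (intro CollectI exI[of _ d] exI[of _ \<phi>'] exI[of _ \<psi>'] conjI refl range that)
    have real: "realizes N x (canonical_ext M N p (range h \<union> set xs'))"
      using Suc.prems(5)[of m] xs nth_append_length[of xs' x] by (simp del: nth_append_length)
    have "sat N d ((!) [x]) \<phi> \<longleftrightarrow> sat N h ((!) xs') \<Psi>'"
    proof (cases "sat N h ((!) xs') \<Psi>'")
      case True
      then have "inst d \<phi> \<in> canonical_ext M N p (range h \<union> set xs')"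
        by (intro mem[OF defs(1)] allI) (simp add: sat\<psi>)
      then show ?thesis using real True by (auto simp: realizes_def sat_inst)
    next
      case False
      then have "\<forall>v. sat N d v (Neg \<psi>)" using sat\<psi> by simp
      then have "inst d (Neg \<phi>) \<in> canonical_ext M N p (range h \<union> set xs')"
        by (rule mem[OF defs(2)])
      then show ?thesis using real False by (auto simp: realizes_def sat_inst)
    qed
    then show ?thesis using sat\<phi> xs by simp
  qed
  ultimately show ?case using IH by (simp only:)
qed

end

section \<open>Coordinates in a finite field extension\<close>

locale finite_extension =
  fixes \<iota> :: "'k::field \<Rightarrow> 'l::field" and e :: "'l list"
  assumes emb: "field_embedding \<iota>" and bas: "basis \<iota> e"
begin

lemma \<iota>_1: "\<iota> 1 = 1" and \<iota>_add: "\<iota> (x + y) = \<iota> x + \<iota> y" and \<iota>_mult: "\<iota> (x * y) = \<iota> x * \<iota> y"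
  using emb by (auto simp: field_embedding_def)

lemma \<iota>_0: "\<iota> 0 = 0"
  using \<iota>_add[of 0 0] by (metis add_0 add_left_imp_eq add.right_neutral)

lemma \<iota>_minus: "\<iota> (- x) = - \<iota> x"
  using \<iota>_add[of x "- x"] \<iota>_0 by (simp add: eq_neg_iff_add_eq_0 add.commute)

lemma \<iota>_diff: "\<iota> (x - y) = \<iota> x - \<iota> y"
  using \<iota>_add[of x "- y"] \<iota>_minus by simp

lemma \<iota>_eq_0_iff: "\<iota> x = 0 \<longleftrightarrow> x = 0"
proof
  assume "\<iota> x = 0"
  show "x = 0"
  proof (rule ccontr)
    assume "x \<noteq> 0"
    then have "\<iota> x * \<iota> (inverse x) = 1" by (simp flip: \<iota>_mult add: \<iota>_1)
    then show False using \<open>\<iota> x = 0\<close> by simp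
  qed
qed (simp add: \<iota>_0)

sublocale V: vector_space "\<lambda>a x. \<iota> a * x"
  by unfold_locales (auto simp: \<iota>_1 \<iota>_add \<iota>_mult algebra_simps)

declare V.scale_scale [simp del]

abbreviation "n \<equiv> length e"

lemma sum_set_basis: "(\<Sum>v\<in>set e. f v) = (\<Sum>i<n. f (e ! i))"
  using bas by (intro sum.reindex_bij_betw[symmetric] bij_betw_nth) (auto simp: basis_def)

lemma ex_coords: "\<exists>a. length a = n \<and> of_coords \<iota> e a = x"
proof -
  have "x \<in> V.span (set e)" using bas by (simp add: basis_def)
  then obtain u where "x = (\<Sum>v\<in>set e. \<iota> (u v) * v)" by (auto simp: V.span_finite)
  then have "of_coords \<iota> e (map u e) = x" by (simp add: of_coords_def sum_set_basis)
  then show ?thesis by (intro exI[of _ "map u e"]) simp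
qed

definition co :: "'l \<Rightarrow> 'k list" where
  "co x = (SOME a. length a = n \<and> of_coords \<iota> e a = x)"

lemma length_co: "length (co x) = n" and of_coords_co: "of_coords \<iota> e (co x) = x"
  using someI_ex[OF ex_coords[of x]] by (auto simp: co_def)

lemma co_expand: "x = (\<Sum>i<n. \<iota> (co x ! i) * e ! i)"
  using of_coords_co[of x] by (simp add: of_coords_def)

lemma coefficients_unique:
  assumes "(\<Sum>i<n. \<iota> (f i) * e ! i) = (\<Sum>i<n. \<iota> (g i) * e ! i)" "i < n"
  shows "f i = g i"
proof -
  have d: "distinct e" and ind: "\<not> V.dependent (set e)" using bas by (auto simp: basis_def)
  \<comment> \<open>Linear independence concerns coefficients attached to vectors. As
    \<open>e\<close> is distinct, the difference of the coefficients can be moved from indices to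
    vectors.\<close>
  define u where "u v = (let j = (THE j. j < n \<and> e ! j = v) in f j - g j)" for v
  have u: "u (e ! j) = f j - g j" if "j < n" for j
  proof -
    have "(THE j'. j' < n \<and> e ! j' = e ! j) = j"
      using d that by (intro the_equality) (auto simp: nth_eq_iff_index_eq)
    then show ?thesis by (simp add: u_def)
  qed
  have "(\<Sum>v\<in>set e. \<iota> (u v) * v) = 0"
    using assms(1) by (simp add: \<iota>_diff sum_set_basis u sum_subtractf left_diff_distrib)
  then have "\<forall>v\<in>set e. u v = 0" using ind by (auto simp: V.dependent_finite)
  then have "u (e ! i) = 0" using assms(2) by simp
  then show ?thesis using u assms(2) by simp
qed

lemma co_eqI: "x = (\<Sum>i<n. \<iota> (f i) * e ! i) \<Longrightarrow> i < n \<Longrightarrow> co x ! i = f i"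
  using coefficients_unique[of "\<lambda>i. co x ! i" f i] co_expand[of x] by simp

lemma eq_if_co_eq: "(\<And>i. i < n \<Longrightarrow> co x ! i = co y ! i) \<Longrightarrow> x = y"
  by (subst co_expand[of x], subst co_expand[of y]) simp

lemma co_of_coords: "length a = n \<Longrightarrow> co (of_coords \<iota> e a) = a"
  by (intro nth_equalityI) (auto simp: length_co of_coords_def intro: co_eqI)

lemma co_add: "i < n \<Longrightarrow> co (x + y) ! i = co x ! i + co y ! i"
  by (rule co_eqI[where f = "\<lambda>i. co x ! i + co y ! i"])
    (simp_all add: \<iota>_add distrib_right sum.distrib flip: co_expand)

lemma co_scale:
  assumes "i < n" shows "co (\<iota> a * x) ! i = a * co x ! i"
proof (rule co_eqI[where f = "\<lambda>i. a * co x ! i", OF _ assms])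
  have "(\<Sum>i<n. \<iota> (a * co x ! i) * e ! i) = \<iota> a * (\<Sum>i<n. \<iota> (co x ! i) * e ! i)"
    by (simp add: \<iota>_mult mult.assoc sum_distrib_left)
  then show "\<iota> a * x = (\<Sum>i<n. \<iota> (a * co x ! i) * e ! i)"
    by (simp only: co_expand[symmetric])
qed

lemma co_0: "i < n \<Longrightarrow> co 0 ! i = 0"
  by (rule co_eqI[where f = "\<lambda>_. 0"]) (simp_all add: \<iota>_0)

lemma co_sum: "i < n \<Longrightarrow> co (sum f X) ! i = (\<Sum>x\<in>X. co (f x) ! i)"
  by (induction X rule: infinite_finite_induct) (auto simp: co_0 co_add)

lemma co_basis: "i < n \<Longrightarrow> j < n \<Longrightarrow> co (e ! j) ! i = (if i = j then 1 else 0)"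
  by (rule co_eqI[where f = "\<lambda>i. if i = j then 1 else 0"]) (simp_all add: if_distrib[of \<iota>] if_distrib[of "\<lambda>x. x * _"] \<iota>_0 \<iota>_1 cong: if_cong)

lemma co_mult:
  assumes "k < n"
  shows "co (x * y) ! k = (\<Sum>i<n. \<Sum>j<n. co x ! i * co y ! j * co (e ! i * e ! j) ! k)"
proof -
  have "x * y = (\<Sum>i<n. \<Sum>j<n. \<iota> (co x ! i * co y ! j) * (e ! i * e ! j))"
    by (subst co_expand[of x], subst co_expand[of y])
      (simp add: sum_product \<iota>_mult mult.assoc mult.left_commute)
  then show ?thesis using assms by (simp add: co_sum co_scale)
qed

lemma two_le_degree:
  assumes "range \<iota> \<noteq> UNIV" shows "2 \<le> n"
proof (rule ccontr)
  assume "\<not> 2 \<le> n"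
  then consider "n = 0" | "n = 1" by linarith
  then show False
  proof cases
    case 1
    then show ?thesis using co_expand[of 1] by simp
  next
    case 2
    then have x: "x = \<iota> (co x ! 0) * e ! 0" for x using co_expand[of x] by simp
    \<comment> \<open>Both \<open>x\<close> and 1 are multiples of \<open>e ! 0\<close>, so
      \<open>x\<close> is the quotient of their coordinates.\<close>
    have "x = \<iota> (co x ! 0 / co 1 ! 0)" for x
    proof -
      have "\<iota> (co 1 ! 0) * e ! 0 = 1" using x[of 1] by simp
      moreover have "co 1 ! 0 \<noteq> 0" using calculation \<iota>_0 by auto
      then have "\<iota> (co x ! 0 / co 1 ! 0) * \<iota> (co 1 ! 0) = \<iota> (co x ! 0)" by (simp flip: \<iota>_mult)
      ultimately show ?thesis using x[of x] by (metis mult.assoc mult.right_neutral)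
    qed
    then show ?thesis using assms by blast
  qed
qed

section \<open>Polynomials over K evaluated in L\<close>

definition ev :: "'l \<Rightarrow> 'k poly \<Rightarrow> 'l" where
  "ev \<beta> f = poly (map_poly \<iota> f) \<beta>"

lemma ev_add: "ev \<beta> (f + g) = ev \<beta> f + ev \<beta> g"
proof -
  have "map_poly \<iota> (f + g) = map_poly \<iota> f + map_poly \<iota> g"
    by (intro poly_eqI) (simp add: coeff_map_poly \<iota>_0 \<iota>_add)
  then show ?thesis by (simp add: ev_def)
qed

lemma ev_smult: "ev \<beta> (smult a f) = \<iota> a * ev \<beta> f"
proof -
  have "map_poly \<iota> (smult a f) = smult (\<iota> a) (map_poly \<iota> f)"
    by (intro poly_eqI) (simp add: coeff_map_poly \<iota>_0 \<iota>_mult)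
  then show ?thesis by (simp add: ev_def)
qed

lemma ev_pCons: "ev \<beta> (pCons a f) = \<iota> a + \<beta> * ev \<beta> f"
  by (simp add: ev_def map_poly_pCons \<iota>_0)

lemma ev_0: "ev \<beta> 0 = 0"
  by (simp add: ev_def)

lemma ev_linear_mult: "ev \<beta> ([:- x, 1:] * f) = (\<beta> - \<iota> x) * ev \<beta> f"
proof -
  have "[:- x, 1:] * f = smult (- x) f + pCons 0 f" by simp
  then show ?thesis by (simp only: ev_add ev_smult ev_pCons) (simp add: \<iota>_minus \<iota>_0 algebra_simps)
qed

lemma ev_altdef: "ev \<beta> f = (\<Sum>i\<le>degree f. \<iota> (coeff f i) * \<beta> ^ i)"
proof -
  have "degree (map_poly \<iota> f) = degree f" by (rule degree_map_poly) (simp add: \<iota>_eq_0_iff)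
  then show ?thesis by (simp add: ev_def poly_altdef coeff_map_poly \<iota>_0)
qed

lemma ev_monom: "ev \<beta> (monom a i) = \<iota> a * \<beta> ^ i"
  by (simp add: ev_def map_poly_monom \<iota>_0 poly_monom)

lemma ev_sum: "ev \<beta> (sum f X) = (\<Sum>x\<in>X. ev \<beta> (f x))"
  by (induction X rule: infinite_finite_induct) (auto simp: ev_0 ev_add)

lemma finite_ev_roots: "f \<noteq> 0 \<Longrightarrow> finite {x. ev x f = 0}"
  unfolding ev_def by (intro poly_roots_finite) (simp add: map_poly_eq_0_iff \<iota>_0 \<iota>_eq_0_iff)

text \<open>The powers of \<open>\<beta>\<close> up to exponent \<open>n\<close> are one more than
  the dimension. Since dependence is a property of sets, a repeated power is treated apart: it gives
  a difference of two monomials.\<close>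

lemma ex_annihilating_poly: "\<exists>f. f \<noteq> 0 \<and> degree f \<le> n \<and> ev \<beta> f = 0"
proof (cases "inj_on (\<lambda>i. \<beta> ^ i) {..n}")
  case False
  then obtain i j where ij: "i \<le> n" "j \<le> n" "i \<noteq> j" "\<beta> ^ i = \<beta> ^ j" by (auto simp: inj_on_def)
  let ?f = "monom 1 i + monom (- 1) j :: 'k poly"
  have "coeff ?f i = 1" using ij by simp
  then have "?f \<noteq> 0" by (metis coeff_0 zero_neq_one)
  moreover have "degree ?f \<le> n" using ij degree_monom_le order_trans by (intro degree_add_le) blast+
  moreover have "ev \<beta> ?f = 0" using ij by (simp add: ev_add ev_monom \<iota>_1 \<iota>_minus)
  ultimately show ?thesis by blast
next
  case True
  let ?S = "(\<lambda>i. \<beta> ^ i) ` {..n}"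
  have "card ?S = Suc n" using True by (simp add: card_image)
  moreover have "card (set e) = n" using bas by (simp add: basis_def distinct_card)
  moreover have "?S \<subseteq> V.span (set e)" using bas by (simp add: basis_def)
  ultimately have "V.dependent ?S"
    using V.independent_span_bound[of "set e" ?S] by fastforce
  then obtain u i where u: "(\<Sum>v\<in>?S. \<iota> (u v) * v) = 0" "i \<le> n" "u (\<beta> ^ i) \<noteq> 0"
    by (subst (asm) V.dependent_finite) auto
  let ?f = "\<Sum>j\<le>n. monom (u (\<beta> ^ j)) j"
  have "coeff ?f i = u (\<beta> ^ i)" using u(2) by (simp add: coeff_sum)
  then have "?f \<noteq> 0" using u(3) by (metis coeff_0)
  moreover have "degree ?f \<le> n"
    using degree_monom_le order_trans by (intro degree_sum_le) (auto, blast)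
  moreover have "ev \<beta> ?f = 0"
    using u(1) True by (simp add: ev_sum ev_monom sum.reindex)
  ultimately show ?thesis by blast
qed

lemma ex_minimal_poly:
  "\<exists>f. lead_coeff f = 1 \<and> degree f \<le> n \<and> ev \<beta> f = 0 \<and>
    (\<forall>g. g \<noteq> 0 \<longrightarrow> ev \<beta> g = 0 \<longrightarrow> degree f \<le> degree g)"
proof -
  let ?P = "\<lambda>f. f \<noteq> 0 \<and> ev \<beta> f = 0"
  obtain f0 where f0: "f0 \<noteq> 0" "degree f0 \<le> n" "ev \<beta> f0 = 0" using ex_annihilating_poly by blast
  then obtain f where f: "?P f" "\<And>g. ?P g \<Longrightarrow> degree f \<le> degree g"
    using ex_has_least_nat[of ?P f0 degree] by blast
  let ?f = "smult (inverse (lead_coeff f)) f"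
  have "degree ?f = degree f" using f by simp
  moreover have "lead_coeff ?f = 1" using f by simp
  moreover have "ev \<beta> ?f = 0" using f by (simp add: ev_smult)
  ultimately show ?thesis using f f0 by (metis (no_types, lifting) order_trans)
qed

end

section \<open>Automorphisms acting on the extension\<close>

locale regular_field_extension =
  regular_field_structure M \<kappa> p A + finite_extension \<iota> e
  for M :: "('f, 'r, 'k::field) struct" and \<kappa> :: "'c rel" and p A
    and \<iota> :: "'k \<Rightarrow> 'l::field" and e
begin

text \<open>The coordinates of 1 are included so that \<open>lift g\<close> also respects the
  embedding of K, see \<open>lift_\<iota>\<close>.\<close>

definition structure_constants :: "'k set" where
  "structure_constants = set (co 1) \<union> (\<Union>i<n. \<Union>j<n. set (co (e ! i * e ! j)))"

lemma finite_structure_constants: "finite structure_constants"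
  by (simp add: structure_constants_def)

text \<open>If \<open>g\<close> is an automorphism fixing the structure constants, this is a ring
  homomorphism of L that extends \<open>g\<close>.\<close>

definition lift :: "('k \<Rightarrow> 'k) \<Rightarrow> 'l \<Rightarrow> 'l" where
  "lift g x = (\<Sum>i<n. \<iota> (g (co x ! i)) * e ! i)"

lemma co_lift: "i < n \<Longrightarrow> co (lift g x) ! i = g (co x ! i)"
  by (rule co_eqI[where f = "\<lambda>i. g (co x ! i)"]) (simp_all add: lift_def)

lemma lift_add: "g \<in> auts B \<Longrightarrow> lift g (x + y) = lift g x + lift g y"
  by (rule eq_if_co_eq) (simp add: co_lift co_add auts_add)

text \<open>In coordinates the product is bilinear with the structure constants as coefficients
  (\<open>co_mult\<close>), and \<open>g\<close> fixes these.\<close>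

lemma lift_mult:
  assumes "g \<in> auts B" "structure_constants \<subseteq> B"
  shows "lift g (x * y) = lift g x * lift g y"
proof (rule eq_if_co_eq)
  fix k assume k: "k < n"
  have fixed: "g (co (e ! i * e ! j) ! k) = co (e ! i * e ! j) ! k" if "i < n" "j < n" for i j
  proof -
    have "co (e ! i * e ! j) ! k \<in> set (co (e ! i * e ! j))" using k by (simp add: length_co)
    then have "co (e ! i * e ! j) ! k \<in> structure_constants"
      using that unfolding structure_constants_def by blast
    then show ?thesis using assms autsD by blast
  qed
  have "co (lift g (x * y)) ! k
      = (\<Sum>i<n. \<Sum>j<n. g (co x ! i) * g (co y ! j) * g (co (e ! i * e ! j) ! k))"
    by (simp add: co_lift[OF k] co_mult[OF k, of x y] auts_sum[OF assms(1)] auts_mult[OF assms(1)])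
  also have "\<dots> = co (lift g x * lift g y) ! k"
    by (simp add: co_mult[OF k, of "lift g x" "lift g y"] co_lift fixed)
  finally show "co (lift g (x * y)) ! k = co (lift g x * lift g y) ! k" .
qed

lemma lift_fixed: "g \<in> auts B \<Longrightarrow> set (co x) \<subseteq> B \<Longrightarrow> lift g x = x"
  by (rule eq_if_co_eq) (metis autsD co_lift length_co nth_mem subsetD)

lemma lift_\<iota>:
  assumes "g \<in> auts B" "structure_constants \<subseteq> B"
  shows "lift g (\<iota> a) = \<iota> (g a)"
proof (rule eq_if_co_eq)
  fix i assume i: "i < n"
  have "co (\<iota> a) ! i = a * co 1 ! i" for a using co_scale[OF i, of a 1] by simp
  moreover have "co 1 ! i \<in> B"
    using assms(2) i length_co[of 1] by (auto simp: structure_constants_def)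
  ultimately show "co (lift g (\<iota> a)) ! i = co (\<iota> (g a)) ! i"
    using assms(1) i by (simp add: co_lift auts_mult autsD)
qed

lemma lift_0: "g \<in> auts B \<Longrightarrow> lift g 0 = 0"
  by (rule eq_if_co_eq) (simp add: co_lift co_0 auts_0)

lemma lift_sum: "g \<in> auts B \<Longrightarrow> lift g (sum f X) = (\<Sum>x\<in>X. lift g (f x))"
  by (induction X rule: infinite_finite_induct) (auto simp: lift_0 lift_add)

lemma lift_1: "g \<in> auts B \<Longrightarrow> structure_constants \<subseteq> B \<Longrightarrow> lift g 1 = 1"
  using lift_\<iota>[of g B 1] by (simp add: \<iota>_1 auts_1)

lemma lift_power: "g \<in> auts B \<Longrightarrow> structure_constants \<subseteq> B \<Longrightarrow> lift g (x ^ m) = lift g x ^ m"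
  by (induction m) (auto simp: lift_1 lift_mult)

section \<open>Roots of polynomials under automorphisms\<close>

lemma lift_root:
  assumes "g \<in> auts B" "structure_constants \<subseteq> B" "ev x f = 0" "\<And>i. g (coeff f i) = coeff f i"
  shows "ev (lift g x) f = 0"
proof -
  have "ev (lift g x) f = lift g (ev x f)"
    by (simp add: ev_altdef assms(4) lift_sum[OF assms(1)] lift_mult[OF assms(1,2)]
        lift_power[OF assms(1,2)] lift_\<iota>[OF assms(1,2)])
  then show ?thesis using assms(1,3) lift_0 by metis
qed

lemma aut_root:
  assumes "g \<in> auts B" "poly f x = 0" "degree f' = degree f" "\<And>i. g (coeff f i) = coeff f' i"
  shows "poly f' (g x) = 0"
proof -
  have "poly f' (g x) = g (poly f x)"
    by (simp add: poly_altdef assms(3,4) auts_sum[OF assms(1)] auts_mult[OF assms(1)]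
        auts_power[OF assms(1)])
  then show ?thesis using assms(1,2) auts_0 by metis
qed

text \<open>A monic polynomial of degree n is thus determined by n coefficients, the number that the
  dimension count needs.\<close>

lemma coeff_monic_eq:
  assumes "lead_coeff f = 1"
  shows "coeff f i \<in> insert 0 (insert 1 (coeff f ` {..<degree f}))"
  using assms by (cases i "degree f" rule: linorder_cases) (auto simp: coeff_eq_0)

lemma auts_fix_coeff:
  assumes "g \<in> auts (B \<union> set (map (coeff f) [0..<degree f]))" "lead_coeff f = 1"
  shows "g (coeff f i) = coeff f i"
proof -
  have "g a = a" if "a \<in> coeff f ` {..<degree f}" for a
    using assms(1) that by (intro autsD[OF assms(1)]) auto
  then have "\<forall>a\<in>insert 0 (insert 1 (coeff f ` {..<degree f})). g a = a"
    using auts_0[OF assms(1)] auts_1[OF assms(1)] by simp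
  then show ?thesis using coeff_monic_eq[OF assms(2)] by (rule bspec)
qed

lemma roots_in_cl_coeffs:
  assumes "base B" "lead_coeff f = 1" "poly f x = 0"
  shows "x \<in> cl (B \<union> set (map (coeff f) [0..<degree f]))"
proof -
  let ?C = "B \<union> set (map (coeff f) [0..<degree f])"
  have "f \<noteq> 0" using assms(2) by auto
  have "{x. poly f x = 0} \<subseteq> cl ?C"
  proof (rule finite_invariant_subset_cl)
    show "base ?C" using assms(1) by (intro base_Un) auto
    show "finite {x. poly f x = 0}" using \<open>f \<noteq> 0\<close> by (rule poly_roots_finite)
    fix g y assume g: "g \<in> auts ?C" and "y \<in> {x. poly f x = 0}"
    then show "g y \<in> {x. poly f x = 0}"
      using aut_root[OF g, of f y f] auts_fix_coeff[OF g assms(2)] by simp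
  qed
  then show ?thesis using assms(3) by blast
qed

text \<open>Lifts of automorphisms that fix the coefficients map roots to roots, so the coordinates
  of all roots form a finite invariant set.\<close>

lemma ev_roots_in_cl_coeffs:
  assumes "base B" "structure_constants \<subseteq> B" "lead_coeff f = 1" "ev x f = 0"
  shows "set (co x) \<subseteq> cl (B \<union> set (map (coeff f) [0..<degree f]))"
proof -
  let ?C = "B \<union> set (map (coeff f) [0..<degree f])"
  let ?X = "\<Union>x\<in>{x. ev x f = 0}. set (co x)"
  have "f \<noteq> 0" using assms(3) by auto
  have "?X \<subseteq> cl ?C"
  proof (rule finite_invariant_subset_cl)
    show "base ?C" using assms(1) by (intro base_Un) auto
    show "finite ?X" using finite_ev_roots[OF \<open>f \<noteq> 0\<close>] by simp
    fix g a assume g: "g \<in> auts ?C" and "a \<in> ?X"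
    then obtain y i where y: "ev y f = 0" "i < n" "a = co y ! i"
      by (auto simp: in_set_conv_nth length_co)
    have "ev (lift g y) f = 0"
      using assms(2) y(1) auts_fix_coeff[OF g assms(3)] by (intro lift_root[OF g]) auto
    moreover have "g a = co (lift g y) ! i" using y co_lift by simp
    then have "g a \<in> set (co (lift g y))" using y(2) length_co by simp
    ultimately show "g a \<in> ?X" by blast
  qed
  then show ?thesis using assms(4) by blast
qed

lemma ex_split_poly:
  fixes a :: "'k list"
  shows "\<exists>f. lead_coeff f = 1 \<and> degree f = length a \<and> (\<forall>x\<in>set a. poly f x = 0)"
proof (induction a)
  case Nil
  then show ?case by (intro exI[of _ 1]) auto
next
  case (Cons x a)
  then obtain f where f: "lead_coeff f = 1" "degree f = length a" "\<forall>x\<in>set a. poly f x = 0" by blast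
  then have "f \<noteq> 0" by auto
  then have "degree ([:- x, 1:] * f) = Suc (degree f)" by (subst degree_mult_eq) auto
  moreover have "lead_coeff ([:- x, 1:] * f) = 1" using f(1) by (simp only: lead_coeff_mult) simp
  ultimately show ?case using f by (intro exI[of _ "[:- x, 1:] * f"]) auto
qed

lemma not_symmetric_over:
  assumes "range \<iota> \<noteq> UNIV"
  shows "\<exists>B. base B \<and> \<not> symmetric_over B"
proof (rule ccontr)
  assume "\<not> (\<exists>B. base B \<and> \<not> symmetric_over B)"
  then have sym: "\<And>B. base B \<Longrightarrow> symmetric_over B" by blast
  define B where "B = A \<union> structure_constants"
  have B: "base B" "structure_constants \<subseteq> B"
    unfolding B_def using base_Un[OF base_A finite_structure_constants] by auto
  obtain b where b: "length b = n" "indep B b" using ex_indep[OF B(1)] by blast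
  define \<beta> where "\<beta> = of_coords \<iota> e b"
  obtain f where f: "lead_coeff f = 1" "degree f \<le> n" "ev \<beta> f = 0"
    and min: "\<And>g. g \<noteq> 0 \<Longrightarrow> ev \<beta> g = 0 \<Longrightarrow> degree f \<le> degree g"
    using ex_minimal_poly[of \<beta>] by blast
  let ?c = "map (coeff f) [0..<degree f]"
  have "co \<beta> = b" using b co_of_coords by (simp add: \<beta>_def)
  then have bc: "set b \<subseteq> cl (B \<union> set ?c)" using ev_roots_in_cl_coeffs[OF B f(1,3)] by simp
  \<comment> \<open>The n independent coordinates of \<open>\<beta>\<close> lie in the closure of
    the lower coefficients of its minimal polynomial, which forces the degree up to n.\<close>
  have "length b \<le> card (set ?c)"
    using indep_length_le[OF sym B(1) b(2) _ bc] by simp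
  also have "\<dots> \<le> degree f" using card_length[of ?c] by simp
  finally have deg: "degree f = n" using f(2) b(1) by simp
  have c: "indep B ?c" using indep_if_spans[OF sym B(1) b(2) _ bc] b(1) deg by simp
  obtain a where a: "length a = n" "indep B a" using ex_indep[OF B(1)] by blast
  obtain f' where f': "lead_coeff f' = 1" "degree f' = n" "\<forall>x\<in>set a. poly f' x = 0"
    using ex_split_poly[of a] a(1) by auto
  let ?d = "map (coeff f') [0..<degree f']"
  have "set a \<subseteq> cl (B \<union> set ?d)" using roots_in_cl_coeffs[OF B(1) f'(1)] f'(3) by blast
  then have d: "indep B ?d" using indep_if_spans[OF sym B(1) a(2)] a(1) f'(2) by simp
  obtain g where g: "g \<in> auts B" "map g ?d = ?c"
    using conjugate_indep[OF B(1) d c] deg f'(2) by auto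
  have "g (coeff f' i) = coeff f i" for i
  proof (cases i n rule: linorder_cases)
    case less
    then show ?thesis using arg_cong[OF g(2), of "\<lambda>xs. xs ! i"] deg f'(2) by simp
  next
    case equal
    then show ?thesis using f(1) f'(1,2) deg auts_1[OF g(1)] by simp
  next
    case greater
    then show ?thesis using f'(2) deg auts_0[OF g(1)] by (simp add: coeff_eq_0)
  qed
  moreover have "a ! 0 \<in> set a" using two_le_degree[OF assms] a(1) by (intro nth_mem) linarith
  ultimately have "poly f (g (a ! 0)) = 0"
    using aut_root[OF g(1), of f' "a ! 0" f] f'(2,3) deg by simp
  \<comment> \<open>The cofactor has smaller degree than \<open>f\<close>, so by minimality it does
    not vanish at \<open>\<beta>\<close>. Hence the linear factor does, and minimality bounds the
    degree of \<open>f\<close> by 1.\<close>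
  then obtain q where q: "f = [:- g (a ! 0), 1:] * q" by (auto simp: poly_eq_0_iff_dvd)
  have "f \<noteq> 0" using f(1) by auto
  then have "q \<noteq> 0" using q by auto
  then have "degree f = Suc (degree q)" unfolding q by (subst degree_mult_eq) auto
  then have "ev \<beta> q \<noteq> 0" using min[of q] \<open>q \<noteq> 0\<close> by linarith
  then have "\<beta> - \<iota> (g (a ! 0)) = 0" using f(3) unfolding q ev_linear_mult by simp
  then have "ev \<beta> [:- g (a ! 0), 1:] = 0" using ev_linear_mult[of \<beta> "g (a ! 0)" 1] by simp
  then have "degree f \<le> 1" using min[of "[:- g (a ! 0), 1:]"] by simp
  then show False using two_le_degree[OF assms] deg by simp
qed

text \<open>The first coordinate is a linear form in \<open>ys\<close> with coefficients
  \<open>\<rho>\<close> from \<open>B\<close>. Up to a summand in the closure of the earlier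
  entries, it is a nonzero multiple of the last entry that occurs in it, and this entry comes after
  \<open>ys ! 0\<close>.\<close>

lemma first_coordinate_not_in_cl:
  assumes "base B" "indep B ys" "length ys = n" "r \<notin> range \<iota>"
    and rB: "\<And>j. j < n \<Longrightarrow> co (r * e ! j) ! 0 \<in> B"
  shows "co (r * of_coords \<iota> e ys) ! 0 \<notin> cl (insert (ys ! 0) B)"
proof -
  define \<rho> where "\<rho> j = co (r * e ! j) ! 0" for j
  have "n > 0" using co_expand[of 1] by (cases "n = 0") auto
  have lin: "co (r * x) ! 0 = (\<Sum>j<n. \<rho> j * co x ! j)" for x
  proof -
    have "r * x = (\<Sum>j<n. \<iota> (co x ! j) * (r * e ! j))"
      by (subst co_expand[of x]) (simp add: sum_distrib_left mult.left_commute)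
    then show ?thesis
      using \<open>n > 0\<close> by (simp only: co_sum co_scale \<rho>_def) (simp only: mult.commute)
  qed
  define J where "J = {j. 0 < j \<and> j < n \<and> \<rho> j \<noteq> 0}"
  \<comment> \<open>Otherwise multiplication by the unit r - \<open>\<rho> 0\<close> would kill the
    first coordinate of every vector, but that of \<open>e ! 0\<close> is 1.\<close>
  have "J \<noteq> {}"
  proof
    assume "J = {}"
    then have z: "\<rho> j = 0" if "0 < j" "j < n" for j using that by (auto simp: J_def)
    have 1: "co (r * x) ! 0 = \<rho> 0 * co x ! 0" for x
    proof -
      have "(\<Sum>j<n. \<rho> j * co x ! j) = (\<Sum>j\<in>{0}. \<rho> j * co x ! j)"
        using \<open>n > 0\<close> z by (intro sum.mono_neutral_right) auto
      then show ?thesis using lin by simp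
    qed
    have "co ((r + \<iota> (- \<rho> 0)) * x) ! 0 = 0" for x
      unfolding distrib_right co_add[OF \<open>n > 0\<close>] co_scale[OF \<open>n > 0\<close>] 1 by simp
    moreover have "r + \<iota> (- \<rho> 0) \<noteq> 0" using assms(4) \<iota>_minus by auto
    ultimately have "co (e ! 0) ! 0 = 0"
      by (metis nonzero_mult_div_cancel_left times_divide_eq_right)
    then show False using co_basis[of 0 0] \<open>n > 0\<close> by simp
  qed
  \<comment> \<open>The last position is taken because entries are known to be generic only over
    earlier ones.\<close>
  define j where "j = Max J"
  have "finite J" by (simp add: J_def)
  then have "j \<in> J" and max: "\<And>i. i \<in> J \<Longrightarrow> i \<le> j" using \<open>J \<noteq> {}\<close> by (auto simp: j_def)
  then have j: "0 < j" "j < n" "\<rho> j \<noteq> 0" by (simp_all add: J_def)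
  have above: "\<rho> i = 0" if "j < i" "i < n" for i
    using max[of i] that by (auto simp: J_def)
  define D where "D = B \<union> set (take j ys)"
  have D: "base D" unfolding D_def using assms(1) by (intro base_Un) auto
  define s where "s = (\<Sum>i<j. \<rho> i * ys ! i)"
  \<comment> \<open>Being in \<open>cl D\<close>, the constant \<open>s\<close> may join the base,
    where \<open>affine_not_in_cl\<close> wants it, without changing the closure.\<close>
  have "s \<in> cl D"
  proof (rule fixed_in_cl[OF D])
    fix g assume g: "g \<in> auts D"
    have "g (\<rho> i) = \<rho> i" "g (ys ! i) = ys ! i" if "i < j" for i
    proof -
      have "\<rho> i \<in> B" using that j rB by (simp add: \<rho>_def)
      then show "g (\<rho> i) = \<rho> i" using g autsD by (auto simp: D_def)
      have "ys ! i \<in> set (take j ys)" using that j assms(3) by (auto simp: in_set_conv_nth)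
      then show "g (ys ! i) = ys ! i" using g autsD by (auto simp: D_def)
    qed
    then show "g s = s" using g by (simp add: s_def auts_sum auts_mult)
  qed
  then have cl: "cl (insert s D) = cl D" using cl_insert D by simp
  have "co (r * of_coords \<iota> e ys) ! 0 = (\<Sum>i<n. \<rho> i * ys ! i)"
    using lin co_of_coords assms(3) by simp
  also have "\<dots> = (\<Sum>i<Suc j. \<rho> i * ys ! i)"
    using j above by (intro sum.mono_neutral_right) auto
  also have "\<dots> = \<rho> j * ys ! j + s" by (simp add: s_def)
  finally have eq: "co (r * of_coords \<iota> e ys) ! 0 = \<rho> j * ys ! j + s" .
  have "ys ! j \<notin> cl (insert s D)"
    unfolding cl using assms(2,3) j(2) by (simp add: indep_def D_def)
  then have "\<rho> j * ys ! j + s \<notin> cl (insert s D)"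
    using j rB by (intro affine_not_in_cl base_insert D) (auto simp: D_def \<rho>_def)
  moreover have "insert (ys ! 0) B \<subseteq> D"
    using j assms(3) by (auto simp: D_def in_set_conv_nth)
  ultimately show ?thesis using cl_mono[of "insert (ys ! 0) B" D] eq cl by auto
qed

lemma symmetric_over_if_moved:
  assumes "base B" "indep B ys" "length ys = n" "r \<notin> range \<iota>"
    and B: "structure_constants \<subseteq> B" "set (co r) \<subseteq> B"
      "\<And>j. j < n \<Longrightarrow> co (r * e ! j) ! 0 \<in> B" "\<And>j. j < n \<Longrightarrow> co (inverse r * e ! j) ! 0 \<in> B"
    and g: "g \<in> auts B" "lift g (of_coords \<iota> e ys) = r * of_coords \<iota> e ys"
  shows "symmetric_over B"
proof -
  define \<beta> where "\<beta> = of_coords \<iota> e ys"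
  have "n > 0" using co_expand[of 1] by (cases "n = 0") auto
  have "r \<noteq> 0" using assms(4) \<iota>_0 by (metis rangeI)
  have inv: "inverse r \<notin> range \<iota>"
  proof
    assume "inverse r \<in> range \<iota>"
    then obtain a where a: "inverse r = \<iota> a" by blast
    then have "a \<noteq> 0" using \<open>r \<noteq> 0\<close> \<iota>_0 by auto
    then have "\<iota> (inverse a) * \<iota> a = 1" by (simp flip: \<iota>_mult add: \<iota>_1)
    then have "r = \<iota> (inverse a)" using a \<open>r \<noteq> 0\<close> by (metis inverse_inverse_eq inverse_unique mult.commute)
    then show False using assms(4) by blast
  qed
  define x y z where "x = ys ! 0" and "y = co (r * \<beta>) ! 0" and "z = co (inverse r * \<beta>) ! 0"
  have x: "co \<beta> ! 0 = x" using co_of_coords assms(3) by (simp add: \<beta>_def x_def)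
  have "g x = y" using g(2) co_lift[OF \<open>n > 0\<close>, of g \<beta>] x by (simp add: y_def \<beta>_def)
  \<comment> \<open>\<open>lift g\<close> fixes \<open>r\<close>, hence its inverse, so it maps the
    quotient of \<open>\<beta>\<close> by \<open>r\<close> to \<open>\<beta>\<close>.\<close>
  have "lift g (inverse r) * lift g r = 1"
    using lift_mult[OF g(1) B(1)] lift_1[OF g(1) B(1)] \<open>r \<noteq> 0\<close> by (metis left_inverse)
  then have "lift g (inverse r) = inverse r"
    using lift_fixed[OF g(1) B(2)] \<open>r \<noteq> 0\<close> by (metis inverse_unique mult.commute)
  then have "lift g (inverse r * \<beta>) = \<beta>"
    using lift_mult[OF g(1) B(1)] g(2) \<open>r \<noteq> 0\<close> by (simp add: \<beta>_def)
  then have "g z = x" using co_lift[OF \<open>n > 0\<close>, of g "inverse r * \<beta>"] x by (simp add: z_def)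
  have xB: "x \<notin> cl B"
    using assms(2,3) \<open>n > 0\<close> unfolding indep_def x_def by force
  have "z \<notin> cl (insert x B)"
    unfolding z_def x_def \<beta>_def using assms(1-3) inv B(4) by (rule first_coordinate_not_in_cl)
  then have "x \<notin> cl (insert y B)"
    using cl_image[OF g(1), of z "{x}"] assms(1) \<open>g z = x\<close> \<open>g x = y\<close> by (simp add: base_def)
  moreover have "y \<notin> cl (insert x B)"
    unfolding y_def x_def \<beta>_def using assms(1-4) B(3) by (rule first_coordinate_not_in_cl)
  ultimately show ?thesis using assms(1) xB by (intro symmetric_over_witness)
qed

end

section \<open>The action on types\<close>

text \<open>After \<open>c\<close> is plugged in, the second factor of \<open>\<mu>\<close> sits in
  the variables from \<open>n\<close> on. Exchanging the first two blocks, which keeps the renaming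
  injective, puts it at 0 and leaves the product at \<open>2 * n\<close>.\<close>

definition product_fm :: "nat \<Rightarrow> ('f, 'r, 'p) fm \<Rightarrow> 'p list \<Rightarrow> ('f, 'r, 'p) fm" where
  "product_fm n \<mu> c =
    rename (\<lambda>i. if i < n then i + n else if i < 2 * n then i - n else i) (plugs 0 c \<mu>)"

lemma sat_product_fm:
  assumes "\<mu> \<in> fms (3 * n) B" "length c = n"
  shows "sat R d v (product_fm n \<mu> c) \<longleftrightarrow>
    sat R d ((!) (map d c @ map v [0..<n] @ map v [2 * n..<3 * n])) \<mu>"
proof -
  have inj: "inj (\<lambda>i. if i < n then i + n else if i < 2 * n then i - n else i)"
    by (auto simp: inj_def split: if_splits)
  show ?thesis
    unfolding product_fm_def sat_rename[OF inj] sat_plugs using assms(2)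
    by (intro sat_nth_cong[OF assms(1)]) (auto simp: nth_append)
qed

lemma fv_product_fm:
  assumes "\<mu> \<in> fms (3 * n) B" "length c = n"
  shows "fv (product_fm n \<mu> c) \<subseteq> {..<n} \<union> {2 * n..<3 * n}"
proof -
  have "fv (plugs 0 c \<mu>) \<subseteq> {n..<3 * n}"
    using fv_plugs[of 0 c \<mu>] assms by (fastforce simp: fms_def)
  then show ?thesis
    unfolding product_fm_def by (intro order_trans[OF fv_rename]) (fastforce split: if_splits)
qed

lemma pars_product_fm: "pars (product_fm n \<mu> c) = set c \<union> pars \<mu>"
  by (simp add: product_fm_def pars_rename pars_plugs)

text \<open>\<open>\<chi>(c \<cdot> y)\<close> as a formula in \<open>y\<close>.\<close>

definition translate_fm ::
    "nat \<Rightarrow> ('f, 'r, 'p) fm \<Rightarrow> 'p list \<Rightarrow> ('f, 'r, 'p) fm \<Rightarrow> ('f, 'r, 'p) fm" where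
  "translate_fm n \<mu> c \<chi> =
    exs [2 * n..<3 * n] (And (product_fm n \<mu> c) (rename (\<lambda>i. i + 2 * n) \<chi>))"

lemma sat_translate_fm:
  assumes "\<mu> \<in> fms (3 * n) B" "length c = n" "\<chi> \<in> fms n C"
  shows "sat R d v (translate_fm n \<mu> c \<chi>) \<longleftrightarrow>
    (\<exists>z. length z = n \<and> sat R d ((!) (map d c @ map v [0..<n] @ z)) \<mu> \<and> sat R d ((!) z) \<chi>)"
    (is "?l \<longleftrightarrow> ?r")
proof -
  have \<chi>: "sat R d w (rename (\<lambda>i. i + 2 * n) \<chi>) \<longleftrightarrow> sat R d ((!) (map w [2 * n..<3 * n])) \<chi>" for w
    by (subst sat_rename, simp add: inj_def, intro sat_nth_cong[OF assms(3)]) (auto simp: add.commute)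
  have "?l \<longleftrightarrow> (\<exists>w. (\<forall>i. i \<notin> {2 * n..<3 * n} \<longrightarrow> w i = v i) \<and>
      sat R d ((!) (map d c @ map w [0..<n] @ map w [2 * n..<3 * n])) \<mu> \<and>
      sat R d ((!) (map w [2 * n..<3 * n])) \<chi>)"
    by (simp only: translate_fm_def sat_exs sat.simps sat_product_fm[OF assms(1,2)] \<chi> set_upt)
  also have "\<dots> \<longleftrightarrow> ?r"
  proof (intro iffI; elim exE conjE)
    fix w assume w: "\<forall>i. i \<notin> {2 * n..<3 * n} \<longrightarrow> w i = v i"
      "sat R d ((!) (map d c @ map w [0..<n] @ map w [2 * n..<3 * n])) \<mu>"
      "sat R d ((!) (map w [2 * n..<3 * n])) \<chi>"
    then have "map w [0..<n] = map v [0..<n]" by auto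
    with w show ?r by (intro exI[of _ "map w [2 * n..<3 * n]"]) auto
  next
    fix z assume z: "length z = n" "sat R d ((!) (map d c @ map v [0..<n] @ z)) \<mu>"
      "sat R d ((!) z) \<chi>"
    define w where "w i = (if i \<in> {2 * n..<3 * n} then z ! (i - 2 * n) else v i)" for i
    have "map w [0..<n] = map v [0..<n]" "map w [2 * n..<3 * n] = z"
      using z(1) by (auto intro!: nth_equalityI simp: w_def)
    moreover have "\<forall>i. i \<notin> {2 * n..<3 * n} \<longrightarrow> w i = v i" by (simp add: w_def)
    ultimately show "\<exists>w. (\<forall>i. i \<notin> {2 * n..<3 * n} \<longrightarrow> w i = v i) \<and>
      sat R d ((!) (map d c @ map w [0..<n] @ map w [2 * n..<3 * n])) \<mu> \<and>
      sat R d ((!) (map w [2 * n..<3 * n])) \<chi>"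
      using z by (intro exI[of _ w] conjI) (simp_all only:)
  qed
  finally show ?thesis .
qed

lemma translate_fm_fms:
  assumes "\<mu> \<in> fms (3 * n) UNIV" "length c = n" "\<chi> \<in> fms n B" "set c \<subseteq> B" "pars \<mu> \<subseteq> B"
  shows "translate_fm n \<mu> c \<chi> \<in> fms n B"
proof -
  have "fv (rename (\<lambda>i. i + 2 * n) \<chi>) \<subseteq> {2 * n..<3 * n}"
    using assms(3) by (intro order_trans[OF fv_rename]) (auto simp: fms_def)
  then have "fv (translate_fm n \<mu> c \<chi>) \<subseteq> {..<n}"
    using fv_product_fm[OF assms(1,2)] by (auto simp: translate_fm_def fv_exs)
  then show ?thesis
    using assms by (auto simp: fms_def translate_fm_def pars_exs pars_product_fm pars_rename)
qed

context regular_field_extension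
begin

context
  fixes \<mu> :: "('f, 'r, 'k) fm"
  assumes \<mu>: "defines_mult M \<iota> e \<mu>"
begin

section \<open>Multiplication of L read in the extension\<close>

lemma \<mu>_fms: "\<mu> \<in> fms (3 * n) UNIV"
  using \<mu> by (simp add: defines_mult_def)

lemma sat_\<mu>:
  assumes "length x = n" "length y = n" "length z = n"
  shows "sat M id ((!) (x @ y @ z)) \<mu> \<longleftrightarrow> z = co (of_coords \<iota> e x * of_coords \<iota> e y)"
proof -
  have "sat M id ((!) (x @ y @ z)) \<mu> \<longleftrightarrow> of_coords \<iota> e x * of_coords \<iota> e y = of_coords \<iota> e z"
    using \<mu> assms by (simp add: defines_mult_def)
  then show ?thesis using assms(3) co_of_coords of_coords_co by metis
qed

lemma sat_translate_fm_M:
  assumes "length c = n" "\<chi> \<in> fms n B"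
  shows "sat M id v (translate_fm n \<mu> c \<chi>) \<longleftrightarrow>
    sat M id ((!) (co (of_coords \<iota> e c * of_coords \<iota> e (map v [0..<n])))) \<chi>"
proof -
  have "sat M id v (translate_fm n \<mu> c \<chi>) \<longleftrightarrow>
    (\<exists>z. length z = n \<and> sat M id ((!) (c @ map v [0..<n] @ z)) \<mu> \<and> sat M id ((!) z) \<chi>)"
    using sat_translate_fm[OF \<mu>_fms assms, of M id v] by simp
  also have "\<dots> \<longleftrightarrow> (\<exists>z. length z = n \<and>
      z = co (of_coords \<iota> e c * of_coords \<iota> e (map v [0..<n])) \<and> sat M id ((!) z) \<chi>)"
    using sat_\<mu>[OF assms(1), of "map v [0..<n]"] by (intro ex_cong1 conj_cong refl) auto
  finally show ?thesis using length_co by auto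
qed

lemma ext_mult_exists:
  fixes N :: "('f, 'r, 'b) struct"
  assumes "elementary_ext M N h" "length c = n" "length b = n"
  shows "\<exists>z. length z = n \<and> sat N h ((!) (map h c @ b @ z)) \<mu>"
proof -
  \<comment> \<open>Translating a true sentence expresses just that the product exists.\<close>
  let ?T = "Ex 0 (Eq (Var 0) (Var 0)) :: ('f, 'r, 'k) fm"
  have T: "?T \<in> fms n UNIV" by (simp add: fms_def)
  have "sat N h ((!) b) (translate_fm n \<mu> c ?T)"
    using sat_translate_fm_M[OF assms(2) T] by (intro elementary_ext_valid[OF assms(1)]) simp
  moreover have "map ((!) b) [0..<n] = b" using map_nth[of b] assms(3) by (simp only:)
  ultimately show ?thesis using sat_translate_fm[OF \<mu>_fms assms(2) T, of N h "(!) b"] by auto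
qed

lemma ext_mult_unique:
  fixes N :: "('f, 'r, 'b) struct"
  assumes "elementary_ext M N h" "length c = n" "length b = n" "length z = n" "length z' = n"
    and "sat N h ((!) (map h c @ b @ z)) \<mu>" "sat N h ((!) (map h c @ b @ z')) \<mu>"
  shows "z = z'"
proof (rule nth_equalityI)
  fix i assume i: "i < length z"
  \<comment> \<open>A second copy of the product formula shares the factor but keeps its product in
    the variables from \<open>3 * n\<close> on; \<open>?\<theta>\<close> then says that both
    products agree at position \<open>i\<close>.\<close>
  define \<sigma> where "\<sigma> j = (if j < 2 * n then j else j + n)" for j
  have inj: "inj \<sigma>" by (auto simp: inj_def \<sigma>_def split: if_splits)
  let ?P = "product_fm n \<mu> c"
  let ?\<theta> = "Neg (And ?P (And (rename \<sigma> ?P) (Neg (Eq (Var (2 * n + i)) (Var (3 * n + i))))))"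
  have P: "sat R d v (rename \<sigma> ?P) \<longleftrightarrow>
      sat R d ((!) (map d c @ map v [0..<n] @ map v [3 * n..<4 * n])) \<mu>"
    for R :: "('f, 'r, 'd) struct" and d v
  proof -
    have "map (v \<circ> \<sigma>) [0..<n] = map v [0..<n]" by (simp add: \<sigma>_def)
    moreover have "map (v \<circ> \<sigma>) [2 * n..<3 * n] = map v [3 * n..<4 * n]"
      by (rule nth_equalityI) (auto simp: \<sigma>_def algebra_simps)
    ultimately show ?thesis by (simp only: sat_rename[OF inj] sat_product_fm[OF \<mu>_fms assms(2)])
  qed
  have "sat M id v ?\<theta>" for v
  proof -
    have "v (2 * n + i) = v (3 * n + i)"
      if "map v [2 * n..<3 * n] = map v [3 * n..<4 * n]"
      using arg_cong[OF that, of "\<lambda>xs. xs ! i"] i assms(4) by simp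
    moreover have "map v [2 * n..<3 * n] = map v [3 * n..<4 * n]" if "sat M id v ?P" "sat M id v (rename \<sigma> ?P)"
      using that sat_\<mu>[OF assms(2), of "map v [0..<n]"]
      by (simp add: P sat_product_fm[OF \<mu>_fms assms(2)])
    ultimately show ?thesis by auto
  qed
  then have valid: "sat N h w ?\<theta>" for w by (rule elementary_ext_valid[OF assms(1)])
  define w where "w j = (if j < n then b ! j else if j < 3 * n then z ! (j - 2 * n) else z' ! (j - 3 * n))" for j
  have "map w [0..<n] = b" "map w [2 * n..<3 * n] = z" "map w [3 * n..<4 * n] = z'"
    using assms(3-5) by (auto intro!: nth_equalityI simp: w_def)
  then have "sat N h w ?P" "sat N h w (rename \<sigma> ?P)"
    using assms(6,7) by (simp_all only: P sat_product_fm[OF \<mu>_fms assms(2)])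
  then have "w (2 * n + i) = w (3 * n + i)" using valid[of w] by simp
  then show "z ! i = z' ! i" using i assms(4) by (simp add: w_def)
qed (use assms in simp)

lemma sat_translate_fm_N:
  fixes N :: "('f, 'r, 'b) struct"
  assumes "elementary_ext M N h" "length c = n" "length b = n" "\<chi> \<in> fms n B"
  shows "length (ext_mult N h \<mu> c b) = n"
    and "sat N h ((!) b) (translate_fm n \<mu> c \<chi>) \<longleftrightarrow> sat N h ((!) (ext_mult N h \<mu> c b)) \<chi>"
proof -
  obtain z where z: "length z = n" "sat N h ((!) (map h c @ b @ z)) \<mu>"
    using ext_mult_exists[OF assms(1-3)] by blast
  have u: "z' = z" if "length z' = n" "sat N h ((!) (map h c @ b @ z')) \<mu>" for z'
    using ext_mult_unique[OF assms(1-3) that(1) z(1) that(2) z(2)] .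
  have eq: "ext_mult N h \<mu> c b = z"
    unfolding ext_mult_def assms(3)
  proof (rule the_equality)
    fix d assume "length d = n \<and> sat N h ((!) (map h c @ b @ d)) \<mu>"
    then show "d = z" using u by blast
  qed (use z in simp)
  then show "length (ext_mult N h \<mu> c b) = n" using z by simp
  have "map ((!) b) [0..<n] = b" using map_nth[of b] assms(3) by (simp only:)
  then have "sat N h ((!) b) (translate_fm n \<mu> c \<chi>) \<longleftrightarrow>
      (\<exists>z. length z = n \<and> sat N h ((!) (map h c @ b @ z)) \<mu> \<and> sat N h ((!) z) \<chi>)"
    using sat_translate_fm[OF \<mu>_fms assms(2,4), of N h "(!) b"] by (simp only:)
  then show "sat N h ((!) b) (translate_fm n \<mu> c \<chi>) \<longleftrightarrow> sat N h ((!) (ext_mult N h \<mu> c b)) \<chi>"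
    unfolding eq using z u by blast
qed

lemma quotient_in_range:
  fixes N :: "('f, 'r, 'b) struct"
  assumes "range \<iota> \<noteq> UNIV" "elementary_ext M N h" "length b = n"
    and power: "\<And>i. i < n \<Longrightarrow> realizes N (b ! i) (canonical_ext M N p (range h \<union> set (take i b)))"
    and "u \<noteq> 0" and same: "tp N h (ext_mult N h \<mu> (co u) b) = tp N h (ext_mult N h \<mu> (co u') b)"
  shows "u' / u \<in> range \<iota>"
proof (rule ccontr)
  define r where "r = u' / u"
  assume "u' / u \<notin> range \<iota>"
  then have r: "r \<notin> range \<iota>" by (simp add: r_def)
  obtain B0 where B0: "base B0" "\<not> symmetric_over B0" using not_symmetric_over[OF assms(1)] by blast
  \<comment> \<open>The base has to contain what \<open>lift\<close> must fix, the parameters of the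
    translated formulas, and the coefficients required by
    \<open>symmetric_over_if_moved\<close>.\<close>
  define C where "C = structure_constants \<union> pars \<mu> \<union> set (co u) \<union> set (co u') \<union> set (co r)
    \<union> (\<lambda>j. co (r * e ! j) ! 0) ` {..<n} \<union> (\<lambda>j. co (inverse r * e ! j) ! 0) ` {..<n}"
  define B where "B = B0 \<union> C"
  have "finite C" by (simp add: C_def finite_structure_constants finite_pars)
  then have B: "base B" unfolding B_def using B0(1) by (intro base_Un)
  have CB: "C \<subseteq> B" by (simp add: B_def)
  have "\<not> symmetric_over B" using symmetric_over_antimono[OF B0(1) B] B0(2) by (auto simp: B_def)
  obtain ys where ys: "length ys = n" "indep B ys" using ex_indep[OF B] by blast
  define \<beta> where "\<beta> = of_coords \<iota> e ys"
  have ys': "map ((!) ys) [0..<n] = ys" using map_nth[of ys] ys(1) by (simp only:)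
  \<comment> \<open>Over \<open>B\<close>, the coordinates of \<open>s * \<beta>\<close> in K have
    the same type as the product of \<open>s\<close> and \<open>b\<close> in \<open>N\<close>:
    \<open>translate_fm\<close> pulls \<open>\<chi>\<close> back to \<open>ys\<close> and to
    \<open>b\<close>, which \<open>power_type_transfer\<close> compares.\<close>
  have transfer: "sat M id ((!) (co (s * \<beta>))) \<chi> \<longleftrightarrow> sat N h ((!) (ext_mult N h \<mu> (co s) b)) \<chi>"
    if \<chi>: "\<chi> \<in> fms n B" and s: "set (co s) \<subseteq> B" for \<chi> s
  proof -
    have "sat M id ((!) (co (s * \<beta>))) \<chi> \<longleftrightarrow> sat M id ((!) ys) (translate_fm n \<mu> (co s) \<chi>)"
      using sat_translate_fm_M[OF length_co[of s] \<chi>, of "(!) ys"] ys' by (simp add: of_coords_co \<beta>_def)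
    also have "\<dots> \<longleftrightarrow> sat N h ((!) b) (translate_fm n \<mu> (co s) \<chi>)"
    proof (rule power_type_transfer[OF assms(2) B _ ys(2,1) assms(3) power, symmetric])
      show "translate_fm n \<mu> (co s) \<chi> \<in> fms n B"
        using CB s \<chi> by (intro translate_fm_fms \<mu>_fms length_co) (auto simp: C_def)
    qed
    also have "\<dots> \<longleftrightarrow> sat N h ((!) (ext_mult N h \<mu> (co s) b)) \<chi>"
      using assms(2) length_co assms(3) \<chi> by (rule sat_translate_fm_N(2))
    finally show ?thesis .
  qed
  have "\<exists>g\<in>auts B. map g (co (u * \<beta>)) = co (u' * \<beta>)"
  proof (rule conjugate_tuples)
    show "|B| <o \<kappa>" using B by (simp add: base_def)
    fix \<chi> :: "('f, 'r, 'k) fm" assume \<chi>: "\<chi> \<in> fms n B"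
    have "\<chi> \<in> tp N h (ext_mult N h \<mu> (co s) b) \<longleftrightarrow> sat N h ((!) (ext_mult N h \<mu> (co s) b)) \<chi>" for s
      using sat_translate_fm_N(1)[OF assms(2) length_co assms(3) \<chi>] \<chi> by (auto simp: tp_def fms_def)
    moreover have "set (co u) \<subseteq> B" "set (co u') \<subseteq> B" using CB by (auto simp: C_def)
    ultimately show "sat M id ((!) (co (u * \<beta>))) \<chi> \<longleftrightarrow> sat M id ((!) (co (u' * \<beta>))) \<chi>"
      using transfer[OF \<chi>] same by blast
  qed (simp_all add: length_co)
  then obtain g where g: "g \<in> auts B" "map g (co (u * \<beta>)) = co (u' * \<beta>)" by blast
  have sB: "structure_constants \<subseteq> B" using CB by (simp add: C_def)
  have "lift g (u * \<beta>) = u' * \<beta>"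
  proof (rule eq_if_co_eq)
    fix i assume "i < n"
    then show "co (lift g (u * \<beta>)) ! i = co (u' * \<beta>) ! i"
      using arg_cong[OF g(2), of "\<lambda>xs. xs ! i"] by (simp add: co_lift length_co)
  qed
  \<comment> \<open>As \<open>lift g\<close> fixes \<open>u\<close>, this factor cancels, and
    \<open>\<beta>\<close> itself is moved to \<open>r * \<beta>\<close>.\<close>
  moreover have "lift g u = u" using CB by (intro lift_fixed[OF g(1)]) (simp add: C_def)
  ultimately have "u * lift g \<beta> = u' * \<beta>" using lift_mult[OF g(1) sB] by simp
  then have "lift g \<beta> = r * \<beta>" using \<open>u \<noteq> 0\<close> by (simp add: r_def field_simps)
  then have "symmetric_over B"
    using CB by (intro symmetric_over_if_moved[OF B ys(2,1) r sB _ _ _ g(1)]) (auto simp: C_def \<beta>_def)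
  then show False using \<open>\<not> symmetric_over B\<close> by blast
qed

lemma large_orbit:
  fixes N :: "('f, 'r, 'b) struct"
  assumes "range \<iota> \<noteq> UNIV" "elementary_ext M N h" "power_type M N h p n q"
  shows "\<kappa> \<le>o |orbit N h \<mu> (units_coords \<iota> e) n q|"
proof -
  obtain b where b: "length b = n" "q = tp N h b"
    and power: "\<And>i. i < n \<Longrightarrow> realizes N (b ! i) (canonical_ext M N p (range h \<union> set (take i b)))"
    using assms(3) by (auto simp: power_type_def)
  obtain \<alpha> where \<alpha>: "\<alpha> \<notin> range \<iota>" using assms(1) by blast
  define u where "u k = \<iota> k + \<alpha>" for k
  have u0: "u k \<noteq> 0" for k
  proof
    assume "u k = 0"
    then have "\<alpha> = \<iota> (- k)" by (simp add: u_def \<iota>_minus eq_neg_iff_add_eq_0 add.commute)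
    then show False using \<alpha> by blast
  qed
  define F where "F k = tp N h (ext_mult N h \<mu> (co (u k)) b)" for k
  have "inj F"
  proof (rule injI)
    fix k k' assume F: "F k = F k'"
    have "u k' / u k \<in> range \<iota>"
    proof (rule quotient_in_range[OF assms(1,2) b(1)])
      show "tp N h (ext_mult N h \<mu> (co (u k)) b) = tp N h (ext_mult N h \<mu> (co (u k')) b)"
        using F by (simp only: F_def)
    qed (use power u0 in auto)
    then obtain s where "u k' / u k = \<iota> s" by blast
    then have "u k' = \<iota> s * u k" using u0[of k] by (simp add: field_simps)
    \<comment> \<open>As \<open>\<alpha>\<close> is outside the image of K, it is linearly
      independent from 1, so both coefficients in this relation vanish.\<close>
    then have eq: "\<iota> (1 - s) * \<alpha> = \<iota> (s * k - k')"
      by (simp add: u_def \<iota>_add \<iota>_diff \<iota>_mult \<iota>_1 algebra_simps)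
    have "s = 1"
    proof (rule ccontr)
      assume "s \<noteq> 1"
      then have "\<iota> (inverse (1 - s)) * \<iota> (1 - s) = 1" by (simp flip: \<iota>_mult add: \<iota>_1)
      then have "\<alpha> = \<iota> (inverse (1 - s)) * (\<iota> (1 - s) * \<alpha>)" by (simp flip: mult.assoc)
      then have "\<alpha> = \<iota> (inverse (1 - s) * (s * k - k'))" by (simp only: eq \<iota>_mult)
      then show False using \<alpha> by blast
    qed
    then show "k = k'" using eq \<iota>_0 \<iota>_eq_0_iff[of "k - k'"] by simp
  qed
  \<comment> \<open>For a lower bound the single realization \<open>b\<close> of \<open>q\<close>
    suffices.\<close>
  moreover have "range F \<subseteq> orbit N h \<mu> (units_coords \<iota> e) n q"
  proof
    fix t assume "t \<in> range F"
    then obtain k where "t = F k" by blast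
    moreover have "co (u k) \<in> units_coords \<iota> e"
      using u0 by (simp add: units_coords_def length_co of_coords_co)
    ultimately show "t \<in> orbit N h \<mu> (units_coords \<iota> e) n q"
      using b unfolding orbit_def F_def by blast
  qed
  ultimately have "|UNIV :: 'k set| \<le>o |orbit N h \<mu> (units_coords \<iota> e) n q|"
    using card_of_ordLeq[of "UNIV :: 'k set"] by blast
  \<comment> \<open>If K were small, some element would be generic over all of K, contrary to
    \<open>subset_cl\<close>.\<close>
  moreover have "\<not> |UNIV :: 'k set| <o \<kappa>"
    using ex_not_in_cl[of UNIV] subset_cl[of UNIV] by (auto simp: base_def)
  then have "\<kappa> \<le>o |UNIV :: 'k set|"
    using monster card_of_Well_order not_ordLess_iff_ordLeq
    unfolding monster_def card_order_on_def by blast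
  ultimately show ?thesis using ordLeq_transitive by blast
qed

end

end

theorem theorem3p4:
  fixes M :: "('f, 'r, 'k::field) struct"
    and N :: "('f, 'r, 'b) struct"
    and h :: "'k \<Rightarrow> 'b"
    and \<kappa> :: "'c rel"
    and p q :: "('f, 'r, 'k) fm set"
    and \<iota> :: "'k \<Rightarrow> 'l::field"
    and e :: "'l list"
    and n :: nat
    and \<mu> :: "('f, 'r, 'k) fm"
  assumes "expands_field M"
    and "monster \<kappa> M"
    and "strongly_regular \<kappa> M p"
    and "field_embedding \<iota>"
    and "range \<iota> \<noteq> UNIV"
    and "basis \<iota> e"
    and "length e = n"
    and "defines_mult M \<iota> e \<mu>"
    and "elementary_ext M N h"
    and "power_type M N h p n q"
  shows "\<kappa> \<le>o |orbit N h \<mu> (units_coords \<iota> e) n q|"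
proof -
  obtain A where A: "|A| <o \<kappa>" "invariant M A p"
    "\<And>B a. A \<subseteq> B \<Longrightarrow> |B| <o \<kappa> \<Longrightarrow>
      realizes M a (restr p B) \<or> entails M (restr p B) (restr p (insert a B))"
    using assms(3) by (auto simp: strongly_regular_def)
  interpret regular_field_extension M \<kappa> p A \<iota> e
    using assms(1-4,6) A by unfold_locales (auto simp: strongly_regular_def)
  show ?thesis using large_orbit[of \<mu> N h q] assms by simp
qed

end
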